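(* Let $p \geq 2$, $x_0 \in \mathbb{R}^d$, and let $f$ be a non-negative function of class $C^p$ defined on an open neighborhood of $x_0$ in $\mathbb{R}^d$ with $f(x_0)=0$; let $\mathcal{Z}$ denote the set of zeros of $f$. Assume $f$ satisfies the normal Hessian condition at $x_0$ with regularity $k \geq 1$ and dimension $d_0$, i.e. there is a sub-manifold $N$ of $\mathbb{R}^d$ of class $C^k$ and dimension $d_0$ with $x_0 \in N \subset \mathcal{Z}$ such that the rank of $\nabla^2 f(x_0)$ is $d - d_0$. Then there exists an open neighborhood $U$ of $x_0$ in $\mathbb{R}^d$ on which $f$ is defined such that $U \cap \mathcal{Z}$ is a sub-manifold of $\mathbb{R}^d$ of dimension $d_0$ and of class $C^{\max(k,p-1)}$, and there exist functions $f_i \in C^{p-2}(U)$, $1 \leq i \leq d-d_0$, such that \[ \forall x \in U,\quad f(x) = \sum_{i=1}^{d-d_0} f_i(x)^2. \]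
   Context: A subset $N \subset \mathbb{R}^d$ is a sub-manifold of $\mathbb{R}^d$ of class $C^k$ ($k \geq 1$) if for every $x \in N$ there is an integer $d_x$, an open neighborhood $U'$ of $0$ in $\mathbb{R}^{d_x}$, an open set $V \subset \mathbb{R}^d$ and a $C^k$ map $\phi: U' \to \mathbb{R}^d$ with $\phi(0)=x$, $\phi(U') = N \cap V$, $\phi: U' \to \phi(U')$ a homeomorphism, and $d\phi(0)$ injective; $d_x$ is the dimension of $N$ at $x$ (a sub-manifold "of dimension $d_0$" has $d_x=d_0$ at all its points) and $T_xN = d\phi(0)(\mathbb{R}^{d_x})$ is its tangent space. The rank condition is equivalent to the restriction of $d^2f(x_0)$ to $(T_{x_0}N)^\perp$ being positive definite. *)

theory Defs
  imports "HOL-Analysis.Analysis"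
begin

text \<open>Iterated directional (Frechet) derivatives, taken within a set S (S = UNIV for
  ordinary derivatives in an open set; S a linear subspace for chart domains).
  iter_deriv S [v1,...,vj] f x = D_{v1} ... D_{vj} f (x).\<close>
fun iter_deriv :: "'a::real_normed_vector set \<Rightarrow> 'a list \<Rightarrow> ('a \<Rightarrow> 'b::real_normed_vector) \<Rightarrow> 'a \<Rightarrow> 'b" where
  "iter_deriv S [] f = f"
| "iter_deriv S (v # vs) f = (\<lambda>x. frechet_derivative (iter_deriv S vs f) (at x within S) v)"

definition Ck_on :: "nat \<Rightarrow> 'a::real_normed_vector set \<Rightarrow> 'a set \<Rightarrow> ('a \<Rightarrow> 'b::real_normed_vector) \<Rightarrow> bool" where
  "Ck_on k S U f \<longleftrightarrow>
     (\<forall>vs. set vs \<subseteq> S \<and> length vs < k \<longrightarrow> (\<forall>x\<in>U. iter_deriv S vs f differentiable (at x within S))) \<and>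
     (\<forall>vs. set vs \<subseteq> S \<and> length vs \<le> k \<longrightarrow> continuous_on U (iter_deriv S vs f))"

definition hessian :: "(real^'n \<Rightarrow> real) \<Rightarrow> real^'n \<Rightarrow> real^'n^'n" where
  "hessian f x = (\<chi> i j. iter_deriv UNIV [axis i 1, axis j 1] f x)"

text \<open>N is a sub-manifold of R^d of class C^k and dimension m. The chart domain R^m is
  realised (up to a linear isometry) as an m-dimensional linear subspace S of R^d.\<close>
definition submanifold :: "nat \<Rightarrow> nat \<Rightarrow> (real^'n) set \<Rightarrow> bool" where
  "submanifold k m N \<longleftrightarrow>
     (\<forall>x\<in>N. \<exists>S U' V \<phi>. subspace S \<and> dim S = m \<and>
        openin (top_of_set S) U' \<and> 0 \<in> U' \<and> open V \<and>
        Ck_on k S U' (\<phi> :: real^'n \<Rightarrow> real^'n) \<and> \<phi> 0 = x \<and> \<phi> ` U' = N \<inter> V \<and>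
        (\<exists>\<psi>. homeomorphism U' (\<phi> ` U') \<phi> \<psi>) \<and>
        inj_on (frechet_derivative \<phi> (at 0 within S)) S)"

end

theory Submission
  imports Defs
begin

text \<open>
  Let \<open>H\<close> be the Hessian at \<open>x0\<close>, \<open>K\<close> its kernel, \<open>R = K\<^sup>\<bottom>\<close> its range and \<open>P\<close> the orthogonal
  projection onto \<open>K\<close>. The map \<open>\<Phi> x = P x + \<nabla>f x\<close> is of class \<open>C\<^sup>p\<^sup>-\<^sup>1\<close> with invertible
  derivative \<open>P + H\<close> at \<open>x0\<close>, and it sends every zero \<open>x\<close> of \<open>f\<close> to \<open>P x \<in> K\<close>, because zeros are
  critical points. By invariance of domain \<open>\<Phi> ` N\<close> contains a neighbourhood of \<open>\<Phi> x0\<close> in \<open>K\<close>, so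
  near \<open>x0\<close> the zero set is both \<open>N\<close>, of class \<open>C\<^sup>k\<close>, and \<open>\<Phi>\<^sup>-\<^sup>1 ` K\<close>, of class \<open>C\<^sup>p\<^sup>-\<^sup>1\<close>.
  For \<open>q x = \<Phi>\<^sup>-\<^sup>1 (P x)\<close>, the zero of \<open>f\<close> with the same projection as \<open>x\<close>, the vector
  \<open>w = x - q x\<close> lies in \<open>R\<close>, and Taylor's formula on the segment from \<open>q x\<close> to \<open>x\<close> writes \<open>f x\<close>
  as a quadratic form in \<open>w\<close> with \<open>C\<^sup>p\<^sup>-\<^sup>2\<close> coefficients. It is positive definite on \<open>R\<close> at
  \<open>x0\<close>, and a Cholesky factorisation turns it into a sum of squares.
\<close>

section \<open>Calculus of \<open>C\<^sup>k\<close> functions\<close>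

text \<open>The recursion peels off the outermost derivative, while induction on the order of
  smoothness has to split off the innermost one, which is the last entry of the list.\<close>

lemma iter_deriv_snoc:
  "iter_deriv S (vs @ [v]) f = iter_deriv S vs (\<lambda>x. frechet_derivative f (at x within S) v)"
  by (induction vs) auto

lemma Ck_on_0: "Ck_on 0 S U f \<longleftrightarrow> continuous_on U f"
  by (auto simp: Ck_on_def)

text \<open>Replaces the quantification over direction lists by a recursion on the order; most
  closure properties below are inductions on \<open>k\<close> through it.\<close>

lemma Ck_on_Suc:
  "Ck_on (Suc k) S U f \<longleftrightarrow> (\<forall>x\<in>U. f differentiable (at x within S)) \<and> continuous_on U f \<and>
     (\<forall>v\<in>S. Ck_on k S U (\<lambda>x. frechet_derivative f (at x within S) v))" (is "?L \<longleftrightarrow> ?R")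
proof
  assume L: ?L
  have "Ck_on k S U (\<lambda>x. frechet_derivative f (at x within S) v)" if "v \<in> S" for v
    unfolding Ck_on_def iter_deriv_snoc [symmetric]
    using L that unfolding Ck_on_def by auto
  moreover have "\<forall>x\<in>U. f differentiable (at x within S)" "continuous_on U f"
    using L unfolding Ck_on_def by (force dest: spec [of _ "[]"])+
  ultimately show ?R by blast
next
  assume R: ?R
  show ?L
    unfolding Ck_on_def
  proof (intro conjI allI impI ballI)
    fix vs x assume vs: "set vs \<subseteq> S \<and> length vs < Suc k" and x: "x \<in> U"
    show "iter_deriv S vs f differentiable (at x within S)"
    proof (cases vs rule: rev_cases)
      case Nil
      then show ?thesis using R x by auto
    next
      case (snoc ws v)
      then show ?thesis
        using R vs x unfolding Ck_on_def by (auto simp: iter_deriv_snoc)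
    qed
  next
    fix vs assume vs: "set vs \<subseteq> S \<and> length vs \<le> Suc k"
    show "continuous_on U (iter_deriv S vs f)"
    proof (cases vs rule: rev_cases)
      case Nil
      then show ?thesis using R by auto
    next
      case (snoc ws v)
      then show ?thesis
        using R vs unfolding Ck_on_def by (auto simp: iter_deriv_snoc)
    qed
  qed
qed

lemma Ck_on_mono: "Ck_on k S U f \<Longrightarrow> j \<le> k \<Longrightarrow> V \<subseteq> U \<Longrightarrow> Ck_on j S V f"
  unfolding Ck_on_def by (blast intro: continuous_on_subset less_le_trans order_trans)

lemma Ck_on_imp_continuous_on: "Ck_on k S U f \<Longrightarrow> continuous_on U f"
  using Ck_on_mono [of k S U f 0 U] by (simp add: Ck_on_0)

text \<open>Since \<open>U\<close> is open, agreement on \<open>U\<close> is agreement near each of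
  its points, so derivatives of every order transfer.\<close>

lemma Ck_on_cong:
  assumes "open U" "\<And>x. x \<in> U \<Longrightarrow> f x = g x" "Ck_on k UNIV U f"
  shows "Ck_on k UNIV U g"
  using assms(2,3)
proof (induction k arbitrary: f g)
  case 0
  then show ?case by (simp add: Ck_on_0 cong: continuous_on_cong)
next
  case (Suc k)
  have df: "f differentiable (at x)" if "x \<in> U" for x
    using Suc.prems(2) that by (auto simp: Ck_on_Suc)
  have eq: "frechet_derivative f (at x) = frechet_derivative g (at x)" if "x \<in> U" for x
    using frechet_derivative_transform_within_open [OF df [OF that] assms(1) that] Suc.prems(1) by blast
  have "g differentiable (at x)" if "x \<in> U" for x
  proof -
    from df [OF that] obtain D where "(f has_derivative D) (at x)"
      by (auto simp: differentiable_def)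
    from has_derivative_transform_within_open [OF this assms(1) that Suc.prems(1)]
    show ?thesis by (auto simp: differentiable_def)
  qed
  moreover have "continuous_on U g"
    using Suc.prems by (auto simp: Ck_on_Suc cong: continuous_on_cong)
  moreover have "Ck_on k UNIV U (\<lambda>x. frechet_derivative g (at x) v)" for v
    by (rule Suc.IH [of "\<lambda>x. frechet_derivative f (at x) v"])
      (use Suc.prems(2) eq in \<open>auto simp: Ck_on_Suc\<close>)
  ultimately show ?case by (auto simp: Ck_on_Suc)
qed

text \<open>Lets any explicitly known derivative stand in for \<open>frechet_derivative\<close>, so
  that the induction steps below only have to name a derivative formula.\<close>

lemma Ck_on_SucI:
  assumes "open U" "\<And>x. x \<in> U \<Longrightarrow> (f has_derivative f' x) (at x)"
    and "\<And>v. Ck_on k UNIV U (\<lambda>x. f' x v)"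
  shows "Ck_on (Suc k) UNIV U f"
  unfolding Ck_on_Suc
proof (intro conjI ballI)
  show "f differentiable at x" if "x \<in> U" for x
    using assms(2) that by (auto simp: differentiable_def)
  show "continuous_on U f"
    using assms(2) by (auto intro!: continuous_at_imp_continuous_on has_derivative_continuous)
  show "Ck_on k UNIV U (\<lambda>x. frechet_derivative f (at x) v)" for v
    by (rule Ck_on_cong [OF assms(1) _ assms(3)]) (simp add: frechet_derivative_at [OF assms(2), symmetric])
qed

lemma Ck_on_SucE:
  assumes "Ck_on (Suc k) UNIV U f"
  obtains f' where "\<And>x. x \<in> U \<Longrightarrow> (f has_derivative f' x) (at x)"
    and "\<And>v. Ck_on k UNIV U (\<lambda>x. f' x v)"
  using that [of "\<lambda>x. frechet_derivative f (at x)"] assms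
  by (auto simp: Ck_on_Suc frechet_derivative_works)

lemma Ck_on_const: "open U \<Longrightarrow> Ck_on k UNIV U (\<lambda>x. c)"
  by (induction k arbitrary: c)
    (auto simp: Ck_on_0 intro!: Ck_on_SucI [where f' = "\<lambda>_ _. 0"])

lemma Ck_on_bounded_linear:
  assumes "open U" "bounded_linear L" "Ck_on k UNIV U f"
  shows "Ck_on k UNIV U (\<lambda>x. L (f x))"
  using assms(3)
proof (induction k arbitrary: f)
  case 0
  then show ?case
    by (simp add: Ck_on_0 bounded_linear.continuous_on [OF assms(2)])
next
  case (Suc k)
  from Suc.prems obtain f' where f': "\<And>x. x \<in> U \<Longrightarrow> (f has_derivative f' x) (at x)"
    "\<And>v. Ck_on k UNIV U (\<lambda>x. f' x v)" by (rule Ck_on_SucE) blast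
  show ?case
    by (rule Ck_on_SucI [where f' = "\<lambda>x v. L (f' x v)"])
      (use f' Suc.IH assms in \<open>auto intro: bounded_linear.has_derivative\<close>)
qed

lemma Ck_on_id: "open U \<Longrightarrow> Ck_on k UNIV U (\<lambda>x. x)"
  by (cases k) (auto simp: Ck_on_0 intro!: Ck_on_SucI [where f' = "\<lambda>_ v. v"] Ck_on_const)

lemma Ck_on_add:
  assumes "open U" "Ck_on k UNIV U f" "Ck_on k UNIV U g"
  shows "Ck_on k UNIV U (\<lambda>x. f x + g x)"
  using assms(2,3)
proof (induction k arbitrary: f g)
  case 0
  then show ?case by (simp add: Ck_on_0 continuous_on_add)
next
  case (Suc k)
  from Suc.prems(1) obtain f' where f': "\<And>x. x \<in> U \<Longrightarrow> (f has_derivative f' x) (at x)"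
    "\<And>v. Ck_on k UNIV U (\<lambda>x. f' x v)" by (rule Ck_on_SucE) blast
  from Suc.prems(2) obtain g' where g': "\<And>x. x \<in> U \<Longrightarrow> (g has_derivative g' x) (at x)"
    "\<And>v. Ck_on k UNIV U (\<lambda>x. g' x v)" by (rule Ck_on_SucE) blast
  show ?case
    by (rule Ck_on_SucI [where f' = "\<lambda>x v. f' x v + g' x v"])
      (use f' g' Suc.IH assms(1) in \<open>auto intro: has_derivative_add\<close>)
qed

lemma Ck_on_sum:
  assumes "open U" "\<And>i. i \<in> I \<Longrightarrow> Ck_on k UNIV U (f i)"
  shows "Ck_on k UNIV U (\<lambda>x. \<Sum>i\<in>I. f i x)"
  using assms(2)
  by (induction I rule: infinite_finite_induct) (auto intro: Ck_on_add Ck_on_const assms(1))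

text \<open>Product rule: each term of the derivative pairs one factor with a derivative of the
  other, and the induction hypothesis, taken for arbitrary \<open>f\<close> and \<open>g\<close>,
  covers both.\<close>

lemma Ck_on_bounded_bilinear:
  assumes "open U" "bounded_bilinear B" "Ck_on k UNIV U f" "Ck_on k UNIV U g"
  shows "Ck_on k UNIV U (\<lambda>x. B (f x) (g x))"
  using assms(3,4)
proof (induction k arbitrary: f g)
  case 0
  then show ?case by (simp add: Ck_on_0 bounded_bilinear.continuous_on [OF assms(2)])
next
  case (Suc k)
  from Suc.prems(1) obtain f' where f': "\<And>x. x \<in> U \<Longrightarrow> (f has_derivative f' x) (at x)"
    "\<And>v. Ck_on k UNIV U (\<lambda>x. f' x v)" by (rule Ck_on_SucE) blast
  from Suc.prems(2) obtain g' where g': "\<And>x. x \<in> U \<Longrightarrow> (g has_derivative g' x) (at x)"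
    "\<And>v. Ck_on k UNIV U (\<lambda>x. g' x v)" by (rule Ck_on_SucE) blast
  have fg: "Ck_on k UNIV U f" "Ck_on k UNIV U g"
    using Suc.prems by (auto intro: Ck_on_mono)
  show ?case
    by (rule Ck_on_SucI [where f' = "\<lambda>x v. B (f x) (g' x v) + B (f' x v) (g x)"])
      (use f' g' fg Suc.IH assms(1) in
        \<open>auto intro!: Ck_on_add bounded_bilinear.FDERIV [OF assms(2)]\<close>)
qed

lemmas Ck_on_mult = Ck_on_bounded_bilinear [OF _ bounded_bilinear_mult]
lemmas Ck_on_scaleR = Ck_on_bounded_bilinear [OF _ bounded_bilinear_scaleR]

lemma Ck_on_diff:
  assumes "open U" "Ck_on k UNIV U f" "Ck_on k UNIV U g"
  shows "Ck_on k UNIV U (\<lambda>x. f x - g x)"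
  using Ck_on_add [OF assms(1,2) Ck_on_bounded_linear [OF assms(1) bounded_linear_minus [OF bounded_linear_ident] assms(3)]]
  by simp

lemma Ck_on_prod:
  fixes f :: "'i \<Rightarrow> 'a::real_normed_vector \<Rightarrow> real"
  assumes "open U" "\<And>i. i \<in> I \<Longrightarrow> Ck_on k UNIV U (f i)"
  shows "Ck_on k UNIV U (\<lambda>x. \<Prod>i\<in>I. f i x)"
  using assms(2)
  by (induction I rule: infinite_finite_induct) (auto intro: Ck_on_mult Ck_on_const assms(1))

lemma Ck_on_vec_nth:
  "open U \<Longrightarrow> Ck_on k UNIV U f \<Longrightarrow> Ck_on k UNIV U (\<lambda>x. f x $ i)"
  by (rule Ck_on_bounded_linear [OF _ bounded_linear_vec_nth])

lemma Ck_on_vec_lambda: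
  fixes f :: "'n::finite \<Rightarrow> 'a::real_normed_vector \<Rightarrow> real"
  assumes "open U" "\<And>i. Ck_on k UNIV U (f i)"
  shows "Ck_on k UNIV U (\<lambda>x. \<chi> i. f i x)"
proof -
  have "(\<lambda>x. \<chi> i. f i x) = (\<lambda>x. \<Sum>i\<in>UNIV. f i x *\<^sub>R axis i 1)"
    by (auto simp: vec_eq_iff axis_def if_distrib cong: if_cong)
  then show ?thesis
    using assms by (simp add: Ck_on_sum Ck_on_scaleR Ck_on_const)
qed

text \<open>Smoothness of a derivative is available only in fixed directions; this expansion reduces
  a varying direction to the finitely many basis vectors.\<close>

lemma linear_Basis_sum:
  fixes f' :: "'a::euclidean_space \<Rightarrow> 'b::real_normed_vector"
  assumes "linear f'"
  shows "f' v = (\<Sum>b\<in>Basis. (v \<bullet> b) *\<^sub>R f' b)"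
proof -
  have "f' v = f' (\<Sum>b\<in>Basis. (v \<bullet> b) *\<^sub>R b)" by (simp add: euclidean_representation)
  then show ?thesis
    by (simp only: linear_sum [OF assms] linear_cmul [OF assms])
qed

lemma Ck_on_compose:
  fixes g :: "'b::euclidean_space \<Rightarrow> 'c::real_normed_vector"
  assumes "open U" "open V" "Ck_on k UNIV V g" "Ck_on k UNIV U f" "f ` U \<subseteq> V"
  shows "Ck_on k UNIV U (\<lambda>x. g (f x))"
  using assms(3,4)
proof (induction k arbitrary: g)
  case 0
  then show ?case
    using assms(5) by (auto simp: Ck_on_0 intro: continuous_on_compose2)
next
  case (Suc k)
  from Suc.prems(1) obtain g' where g': "\<And>x. x \<in> V \<Longrightarrow> (g has_derivative g' x) (at x)"
    "\<And>v. Ck_on k UNIV V (\<lambda>x. g' x v)" by (rule Ck_on_SucE) blast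
  from Suc.prems(2) obtain f' where f': "\<And>x. x \<in> U \<Longrightarrow> (f has_derivative f' x) (at x)"
    "\<And>v. Ck_on k UNIV U (\<lambda>x. f' x v)" by (rule Ck_on_SucE) blast
  have f: "Ck_on k UNIV U f"
    using Suc.prems by (auto intro: Ck_on_mono)
  \<comment> \<open>The chain rule applies \<open>g'\<close> to the varying direction
    \<open>f' x v\<close>. Expanded over the basis, each factor \<open>g' (f x) b\<close> is a
    composition covered by the induction hypothesis.\<close>
  have "Ck_on k UNIV U (\<lambda>x. \<Sum>b\<in>Basis. (f' x v \<bullet> b) *\<^sub>R g' (f x) b)" for v
    by (intro Ck_on_sum Ck_on_scaleR Suc.IH g' f assms(1)
        Ck_on_bounded_linear [OF _ bounded_linear_inner_left] f')
  then have "Ck_on k UNIV U (\<lambda>x. g' (f x) (f' x v))" for v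
  proof (rule Ck_on_cong [OF assms(1), rotated])
    fix x assume "x \<in> U"
    then have "linear (g' (f x))" using g'(1) assms(5) has_derivative_linear by blast
    then show "(\<Sum>b\<in>Basis. (f' x v \<bullet> b) *\<^sub>R g' (f x) b) = g' (f x) (f' x v)"
      by (simp add: linear_Basis_sum [of "g' (f x)" "f' x v"])
  qed
  moreover have "((\<lambda>x. g (f x)) has_derivative (\<lambda>v. g' (f x) (f' x v))) (at x)" if "x \<in> U" for x
    using has_derivative_compose [OF f'(1) [OF that]] g'(1) assms(5) that by blast
  ultimately show ?case
    by (intro Ck_on_SucI [OF assms(1)])
qed

text \<open>The derivative is a polynomial in \<open>inverse\<close> itself, so each order of
  smoothness yields the next.\<close>

lemma Ck_on_inverse: "Ck_on k UNIV {0<..} (inverse :: real \<Rightarrow> real)"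
proof (induction k)
  case 0
  then show ?case by (auto simp: Ck_on_0 intro!: continuous_intros)
next
  case (Suc k)
  show ?case
  proof (rule Ck_on_SucI)
    show "(inverse has_derivative (\<lambda>v. (inverse x * inverse x) * (- v))) (at x)"
      if "x \<in> {0<..}" for x :: real
      using that by (auto intro!: derivative_eq_intros simp: field_simps)
    show "Ck_on k UNIV {0<..} (\<lambda>x::real. (inverse x * inverse x) * (- v))" for v
      using Suc.IH by (intro Ck_on_mult Ck_on_const) auto
  qed auto
qed

text \<open>Again the derivative is expressed through the function itself, as a multiple of
  \<open>inverse (sqrt x)\<close>.\<close>

lemma Ck_on_sqrt: "Ck_on k UNIV {0<..} sqrt"
proof (induction k)
  case 0
  then show ?case by (auto simp: Ck_on_0 intro!: continuous_intros)
next
  case (Suc k)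
  show ?case
  proof (rule Ck_on_SucI)
    show "(sqrt has_derivative (\<lambda>v. inverse (sqrt x) * (v / 2))) (at x)"
      if "x \<in> {0<..}" for x :: real
      using that by (auto intro!: derivative_eq_intros simp: field_simps)
    show "Ck_on k UNIV {0<..} (\<lambda>x. inverse (sqrt x) * (v / 2))" for v
      by (intro Ck_on_mult Ck_on_const Ck_on_compose [OF _ _ Ck_on_inverse Suc.IH]) auto
  qed auto
qed

lemma Ck_on_det:
  fixes A :: "'a::real_normed_vector \<Rightarrow> real^'n^'n"
  assumes "open U" "\<And>i j. Ck_on k UNIV U (\<lambda>x. A x $ i $ j)"
  shows "Ck_on k UNIV U (\<lambda>x. det (A x))"
  unfolding det_def using assms
  by (intro Ck_on_sum Ck_on_mult Ck_on_const Ck_on_prod)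

text \<open>\<open>inverse\<close> is treated above on positive numbers only; writing the reciprocal
  of \<open>g\<close> as \<open>g * inverse (g * g)\<close> covers both signs.\<close>

lemma Ck_on_divide_nonzero:
  fixes g :: "'a::real_normed_vector \<Rightarrow> real"
  assumes "open U" "Ck_on k UNIV U f" "Ck_on k UNIV U g" "\<And>x. x \<in> U \<Longrightarrow> g x \<noteq> 0"
  shows "Ck_on k UNIV U (\<lambda>x. f x / g x)"
proof -
  have "Ck_on k UNIV U (\<lambda>x. f x * (g x * inverse (g x * g x)))"
    by (intro Ck_on_mult assms Ck_on_compose [OF _ _ Ck_on_inverse])
      (use assms(4) in \<open>auto simp: zero_less_mult_iff not_less less_le\<close>)
  then show ?thesis
    by (rule Ck_on_cong [OF assms(1), rotated]) (use assms(4) in \<open>auto simp: field_simps\<close>)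
qed

text \<open>The line through \<open>x\<close> in direction \<open>v\<close> stays in
  \<open>S\<close>, and along it uniqueness of derivatives on the real line applies.\<close>

lemma has_derivative_within_subspace_unique:
  assumes "(f has_derivative D1) (at x within S)" "(f has_derivative D2) (at x within S)"
    and "subspace S" "x \<in> S" "v \<in> S"
  shows "D1 v = D2 v"
proof -
  have *: "((\<lambda>t. f (x + t *\<^sub>R v)) has_derivative (\<lambda>t. D (t *\<^sub>R v))) (at (0::real))"
    if "(f has_derivative D) (at x within S)" for D
  proof -
    have "((\<lambda>t. x + t *\<^sub>R v) has_derivative (\<lambda>t. t *\<^sub>R v)) (at (0::real))"
      by (auto intro!: derivative_eq_intros)
    moreover have "(f has_derivative D) (at (x + 0 *\<^sub>R v) within range (\<lambda>t::real. x + t *\<^sub>R v))"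
      by (rule has_derivative_subset [where s = S])
        (use that assms in \<open>auto simp: subspace_add subspace_mul\<close>)
    ultimately show ?thesis
      using has_derivative_in_compose [of "\<lambda>t. x + t *\<^sub>R v" "\<lambda>t. t *\<^sub>R v" 0 UNIV f D] by simp
  qed
  show ?thesis
    using has_derivative_unique [OF * [OF assms(1)] * [OF assms(2)]]
    by (metis scaleR_one)
qed

text \<open>By induction on the list, iterated derivatives within \<open>S\<close> along directions
  of \<open>S\<close> coincide on \<open>U \<inter> S\<close> with the ordinary ones. This produces
  charts on subspaces from smooth maps of the whole space.\<close>

lemma Ck_on_restrict_subspace:
  assumes "open U" "subspace S" "Ck_on k UNIV U f"
  shows "Ck_on k S (U \<inter> S) f"
proof -
  \<comment> \<open>All points of \<open>S\<close> close to \<open>x\<close> lie in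
    \<open>U\<close>, so equality on \<open>U \<inter> S\<close> suffices for a derivative within
    \<open>S\<close>.\<close>
  have transform: "(h has_derivative D) (at x within S)"
    if x: "x \<in> U \<inter> S" and g: "(g has_derivative D) (at x within S)"
      and eq: "\<And>y. y \<in> U \<inter> S \<Longrightarrow> g y = h y" for g h :: "'a \<Rightarrow> 'b" and D x
  proof -
    obtain d where "d > 0" "ball x d \<subseteq> U"
      using x assms(1) open_contains_ball by blast
    then show ?thesis
      using x eq by (intro has_derivative_transform_within [OF g]) (auto simp: dist_commute subset_iff)
  qed
  have *: "\<forall>x\<in>U \<inter> S. iter_deriv S vs f x = iter_deriv UNIV vs f x"
    if "set vs \<subseteq> S" "length vs \<le> k" for vs
    using that
  proof (induction vs)
    case (Cons v vs)
    show ?case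
    proof
      fix x assume x: "x \<in> U \<inter> S"
      let ?D = "frechet_derivative (iter_deriv UNIV vs f) (at x)"
      have "(iter_deriv UNIV vs f has_derivative ?D) (at x)"
        using assms(3) x Cons.prems unfolding Ck_on_def by (auto simp: frechet_derivative_works)
      then have "(iter_deriv UNIV vs f has_derivative ?D) (at x within S)"
        by (rule has_derivative_at_withinI)
      then have D: "(iter_deriv S vs f has_derivative ?D) (at x within S)"
        by (rule transform [OF x]) (use Cons in auto)
      then have "(iter_deriv S vs f has_derivative frechet_derivative (iter_deriv S vs f) (at x within S)) (at x within S)"
        by (meson differentiable_def frechet_derivative_works)
      then show "iter_deriv S (v # vs) f x = iter_deriv UNIV (v # vs) f x"
        using has_derivative_within_subspace_unique [OF _ D assms(2)] x Cons.prems by auto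
    qed
  qed auto
  show ?thesis
    unfolding Ck_on_def
  proof (intro conjI allI impI ballI)
    fix vs x assume vs: "set vs \<subseteq> S \<and> length vs < k" and x: "x \<in> U \<inter> S"
    have "(iter_deriv UNIV vs f) differentiable (at x)"
      using assms(3) x vs unfolding Ck_on_def by auto
    then obtain D where "(iter_deriv UNIV vs f has_derivative D) (at x within S)"
      using has_derivative_at_withinI unfolding differentiable_def by blast
    then have "(iter_deriv S vs f has_derivative D) (at x within S)"
      by (rule transform [OF x]) (use * vs in auto)
    then show "iter_deriv S vs f differentiable (at x within S)"
      unfolding differentiable_def by blast
  next
    fix vs assume vs: "set vs \<subseteq> S \<and> length vs \<le> k"
    have "continuous_on (U \<inter> S) (iter_deriv UNIV vs f)"
      using assms(3) vs unfolding Ck_on_def by (auto intro: continuous_on_subset)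
    then show "continuous_on (U \<inter> S) (iter_deriv S vs f)"
      using * [of vs] vs continuous_on_cong [of "U \<inter> S" "U \<inter> S" "iter_deriv S vs f" "iter_deriv UNIV vs f"]
      by simp
  qed
qed

text \<open>The inverse function theorem supplies a differentiable local inverse \<open>G\<close>
  whose derivative at \<open>y\<close> inverts \<open>F' (G y)\<close>. Cramer's rule writes this
  inverse through determinants, so \<open>G'\<close> inherits the regularity of \<open>G\<close>, up
  to order \<open>k\<close>.\<close>

lemma inverse_function_Ck:
  fixes F :: "real^'n \<Rightarrow> real^'n"
  assumes "open U" "x0 \<in> U" and F: "Ck_on (Suc k) UNIV U F"
    and D: "(F has_derivative D) (at x0)" "inj D"
  obtains U' W G where "open U'" "U' \<subseteq> U" "x0 \<in> U'" "open W" "homeomorphism U' W F G"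
    "Ck_on (Suc k) UNIV W G" "\<And>y. y \<in> W \<Longrightarrow> inj (frechet_derivative G (at y))"
proof -
  from F obtain F' where F': "\<And>x. x \<in> U \<Longrightarrow> (F has_derivative F' x) (at x)"
    "\<And>v. Ck_on k UNIV U (\<lambda>x. F' x v)" by (rule Ck_on_SucE) blast
  \<comment> \<open>The inverse function theorem asks for the derivative as a continuous
    operator-valued map; in finite dimension continuity in each direction gives this.\<close>
  define B where "B x = Blinfun (F' x)" for x
  have B: "blinfun_apply (B x) = F' x" if "x \<in> U" for x
    using F'(1) [OF that] by (simp add: B_def bounded_linear_Blinfun_apply has_derivative_bounded_linear)
  have contB: "continuous_on U B"
  proof (rule continuous_on_blinfun_componentwise)
    show "continuous_on U (\<lambda>x. blinfun_apply (B x) i)" for i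
      using Ck_on_imp_continuous_on [OF F'(2) [of i]] B by (simp cong: continuous_on_cong)
  qed
  have D_eq: "F' x0 = D"
    using has_derivative_unique [OF F'(1) [OF assms(2)] D(1)] .
  obtain E where E: "linear E" "E \<circ> D = id"
    using linear_injective_left_inverse [OF has_derivative_linear [OF D(1)] D(2)] by blast
  have "Blinfun E o\<^sub>L B x0 = id_blinfun"
  proof (rule blinfun_eqI)
    fix v
    have "blinfun_apply (Blinfun E) = E"
      using E(1) by (simp add: bounded_linear_Blinfun_apply linear_conv_bounded_linear)
    then show "blinfun_apply (Blinfun E o\<^sub>L B x0) v = blinfun_apply id_blinfun v"
      using B [OF assms(2)] D_eq E(2) by (simp add: pointfree_idE)
  qed
  from inverse_function_theorem [OF assms(1) _ contB assms(2) this] B F'(1)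
  obtain U' W G G' where U': "open U'" "U' \<subseteq> U" "x0 \<in> U'" and W: "open W"
    and hom: "homeomorphism U' W F G"
    and G': "\<And>y. y \<in> W \<Longrightarrow> (G has_derivative (G' y)) (at y)"
      "\<And>y. y \<in> W \<Longrightarrow> G' y = inv (blinfun_apply (B (G y)))"
      "\<And>y. y \<in> W \<Longrightarrow> bij (blinfun_apply (B (G y)))"
    by metis
  have GW: "G y \<in> U" if "y \<in> W" for y
    using hom U'(2) that by (auto simp: homeomorphism_def)
  define A where "A y = matrix (F' (G y))" for y
  have bij: "bij (F' (G y))" if "y \<in> W" for y
    using G'(3) [OF that] B [OF GW [OF that]] by simp
  have lin: "linear (F' (G y))" if "y \<in> W" for y
    using F'(1) [OF GW [OF that]] has_derivative_linear by blast
  have det: "det (A y) \<noteq> 0" if "y \<in> W" for y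
    using bij [OF that] lin [OF that] det_nz_iff_inj [of "F' (G y)"] by (simp add: A_def bij_is_inj)
  have G'_eq: "G' y v = (\<chi> l. det (\<chi> i j. if j = l then v $ i else A y $ i $ j) / det (A y))"
    if "y \<in> W" for y v
  proof -
    have "A y *v G' y v = v"
      using G'(2) [OF that] B [OF GW [OF that]] bij [OF that] lin [OF that]
      by (simp add: A_def matrix_works bij_is_surj surj_f_inv_f)
    then show ?thesis using cramer [OF det [OF that]] by blast
  qed
  \<comment> \<open>Bootstrap on \<open>j\<close> with \<open>F\<close> fixed: if \<open>G\<close>
    is C^j with \<open>j \<le> k\<close>, then so is \<open>G'\<close>, hence \<open>G\<close> is of
    the next class.\<close>
  have "Ck_on j UNIV W G" if "j \<le> Suc k" for j
    using that
  proof (induction j)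
    case 0
    then show ?case using hom by (simp add: Ck_on_0 homeomorphism_def)
  next
    case (Suc j)
    then have G: "Ck_on j UNIV W G" by simp
    have A: "Ck_on j UNIV W (\<lambda>y. A y $ i $ l)" for i l
    proof -
      have "Ck_on j UNIV W (\<lambda>y. F' (G y) (axis l 1))"
        by (rule Ck_on_compose [OF W assms(1) Ck_on_mono [OF F'(2)] G]) (use Suc.prems GW in auto)
      from Ck_on_vec_nth [OF W this, of i] show ?thesis
        by (simp add: A_def matrix_def)
    qed
    show ?case
    proof (rule Ck_on_SucI [OF W G'(1)])
      fix v
      have "Ck_on j UNIV W (\<lambda>y. if l = i then v $ m else A y $ m $ l)" for i l m
        by (cases "l = i") (use A W in \<open>auto intro: Ck_on_const\<close>)
      then have "Ck_on j UNIV W (\<lambda>y. \<chi> l. det (\<chi> i j. if j = l then v $ i else A y $ i $ j) / det (A y))"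
        using A det by (intro Ck_on_vec_lambda W Ck_on_divide_nonzero Ck_on_det) auto
      then show "Ck_on j UNIV W (\<lambda>y. G' y v)"
        by (rule Ck_on_cong [OF W, rotated]) (simp add: G'_eq)
    qed
  qed
  moreover have "inj (frechet_derivative G (at y))" if "y \<in> W" for y
  proof -
    have "frechet_derivative G (at y) = inv (F' (G y))"
      using frechet_derivative_at [OF G'(1) [OF that]] G'(2) [OF that] B [OF GW [OF that]] by simp
    then show ?thesis using bij [OF that] by (simp add: bij_imp_bij_inv bij_is_inj)
  qed
  ultimately show ?thesis using that U' W hom by blast
qed

section \<open>Integrals along segments\<close>

lemma continuous_on_segment_integrand:
  fixes g :: "'b::real_normed_vector \<Rightarrow> real"
  assumes "convex V" "continuous_on V g" "continuous_on {0..1} c"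
  shows "continuous_on ((V \<times> V) \<times> {0..1})
           (\<lambda>(z, t). c t * g (fst z + t *\<^sub>R (snd z - fst z)))"
proof -
  have "continuous_on ((V \<times> V) \<times> {0..1}) (\<lambda>p. c (snd p))"
    by (rule continuous_on_compose2 [OF assms(3)]) (auto intro!: continuous_intros)
  moreover have "continuous_on ((V \<times> V) \<times> {0..1})
      (\<lambda>p. g (fst (fst p) + snd p *\<^sub>R (snd (fst p) - fst (fst p))))"
  proof (rule continuous_on_compose2 [OF assms(2)])
    show "(\<lambda>p. fst (fst p) + snd p *\<^sub>R (snd (fst p) - fst (fst p))) ` ((V \<times> V) \<times> {0..1}) \<subseteq> V"
    proof clarsimp
      fix a b :: 'b and t :: real
      assume "a \<in> V" "b \<in> V" "0 \<le> t" "t \<le> 1"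
      then have "(1 - t) *\<^sub>R a + t *\<^sub>R b \<in> V" using convexD_alt [OF assms(1)] by blast
      then show "a + t *\<^sub>R (b - a) \<in> V" by (simp add: algebra_simps)
    qed
  qed (intro continuous_intros)
  ultimately show ?thesis
    by (auto simp: split_beta intro: continuous_on_mult)
qed

text \<open>Differentiation under the integral sign, jointly in both endpoints of the segment. A
  derivative in direction \<open>dz\<close> creates factors depending on \<open>t\<close>; they are
  absorbed into the weight, which is why \<open>c\<close> is arbitrary in the induction.\<close>

lemma Ck_on_segment_integral_pair:
  fixes h :: "'b::euclidean_space \<Rightarrow> real"
  assumes "open V" "convex V" "Ck_on k UNIV V h" "continuous_on {0..1} c"
  shows "Ck_on k UNIV (V \<times> V)
           (\<lambda>z. integral {0..1} (\<lambda>t. c t * h (fst z + t *\<^sub>R (snd z - fst z))))"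
  using assms(3,4)
proof (induction k arbitrary: c h)
  case 0
  then show ?case
    using integral_continuous_on_param [of "V \<times> V" 0 1 "\<lambda>z t. c t * h (fst z + t *\<^sub>R (snd z - fst z))"]
      continuous_on_segment_integrand [OF assms(2), of h c]
    by (simp add: Ck_on_0)
next
  case (Suc k)
  from Suc.prems(1) obtain h' where h': "\<And>x. x \<in> V \<Longrightarrow> (h has_derivative h' x) (at x)"
    "\<And>v. Ck_on k UNIV V (\<lambda>x. h' x v)" by (rule Ck_on_SucE) blast
  \<comment> \<open>The point of the segment depends linearly on the pair of endpoints, so its
    derivative in direction \<open>dz\<close> is \<open>s dz t\<close>.\<close>
  define s where "s z t = fst z + t *\<^sub>R (snd z - fst z)" for z :: "'b \<times> 'b" and t :: real
  have sV: "s z t \<in> V" if "z \<in> V \<times> V" "t \<in> {0..1}" for z t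
  proof -
    have "(1 - t) *\<^sub>R fst z + t *\<^sub>R snd z \<in> V"
      using that convexD_alt [OF assms(2), of "fst z" "snd z" t] by auto
    then show ?thesis by (simp add: s_def algebra_simps)
  qed
  have blin_s: "bounded_linear (\<lambda>z. s z t)" for t
    unfolding s_def by (intro bounded_linear_intros)
  define Dz where "Dz z t = Blinfun (\<lambda>dz. c t * h' (s z t) (s dz t))" for z t
  have der: "((\<lambda>z. c t * h (s z t)) has_derivative (\<lambda>dz. c t * h' (s z t) (s dz t))) (at z)"
    if "z \<in> V \<times> V" "t \<in> {0..1}" for z t
  proof -
    have "((\<lambda>z. s z t) has_derivative (\<lambda>dz. s dz t)) (at z)"
      using bounded_linear_imp_has_derivative [OF blin_s] by simp
    from has_derivative_compose [OF this h'(1) [OF sV [OF that]]] show ?thesis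
      by (intro has_derivative_mult_right)
  qed
  have Dz: "blinfun_apply (Dz z t) dz = c t * h' (s z t) (s dz t)"
    if "z \<in> V \<times> V" "t \<in> {0..1}" for z t dz
    using has_derivative_bounded_linear [OF der [OF that]]
    by (simp add: Dz_def bounded_linear_Blinfun_apply)
  have h'_sum: "c t * h' (s z t) (s dz t) = (\<Sum>b\<in>Basis. (c t * (s dz t \<bullet> b)) * h' (s z t) b)"
    if "z \<in> V \<times> V" "t \<in> {0..1}" for z t dz
    using linear_Basis_sum [OF has_derivative_linear [OF h'(1) [OF sV [OF that]]], of "s dz t"]
    by (simp add: sum_distrib_left mult_ac)
  have cont_c: "continuous_on {0..1} (\<lambda>t. c t * (s dz t \<bullet> b))" for dz b
    unfolding s_def by (intro continuous_intros Suc.prems)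
  have cont_b: "continuous_on ((V \<times> V) \<times> {0..1}) (\<lambda>(z, t). (c t * (s dz t \<bullet> b)) * h' (s z t) b)" for dz b
    using continuous_on_segment_integrand [OF assms(2) Ck_on_imp_continuous_on [OF h'(2)] cont_c]
    by (simp add: s_def)
  have cont_D: "continuous_on ((V \<times> V) \<times> cbox 0 1) (\<lambda>(z, t). Dz z t)"
  proof (rule continuous_on_blinfun_componentwise)
    fix dz :: "'b \<times> 'b"
    have "continuous_on ((V \<times> V) \<times> {0..1})
        (\<lambda>p. \<Sum>b\<in>Basis. (c (snd p) * (s dz (snd p) \<bullet> b)) * h' (s (fst p) (snd p)) b)"
      using cont_b by (intro continuous_on_sum) (simp add: split_beta)
    then show "continuous_on ((V \<times> V) \<times> cbox 0 1) (\<lambda>p. blinfun_apply (case p of (z, t) \<Rightarrow> Dz z t) dz)"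
      unfolding box_real by (rule continuous_on_eq) (auto simp: Dz h'_sum)
  qed
  have int_f: "(\<lambda>t. c t * h (s z t)) integrable_on cbox 0 1" if "z \<in> V \<times> V" for z
  proof -
    have "continuous_on {0..1} (\<lambda>t. (\<lambda>(z, t). c t * h (fst z + t *\<^sub>R (snd z - fst z))) (z, t))"
      by (rule continuous_on_compose2 [OF continuous_on_segment_integrand
              [OF assms(2) Ck_on_imp_continuous_on [OF Suc.prems(1)] Suc.prems(2)]])
        (use that in \<open>auto intro!: continuous_intros\<close>)
    then show ?thesis
      by (auto intro!: integrable_continuous_real simp: s_def)
  qed
  have cvx: "convex (V \<times> V)" and op: "open (V \<times> V)"
    using assms by (auto intro: convex_Times open_Times)
  have leibniz: "((\<lambda>z. integral (cbox 0 1) (\<lambda>t. c t * h (s z t))) has_derivative integral (cbox 0 1) (Dz z)) (at z within V \<times> V)"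
    if "z \<in> V \<times> V" for z
  proof (rule leibniz_rule [OF _ int_f cont_D that cvx])
    fix z t assume "z \<in> V \<times> V" "t \<in> cbox (0::real) 1"
    moreover from this have "blinfun_apply (Dz z t) = (\<lambda>dz. c t * h' (s z t) (s dz t))"
      using Dz by auto
    ultimately show "((\<lambda>z. c t * h (s z t)) has_derivative blinfun_apply (Dz z t)) (at z within V \<times> V)"
      using der [of z t] by (auto intro: has_derivative_at_withinI)
  qed
  have deriv: "((\<lambda>z. integral {0..1} (\<lambda>t. c t * h (s z t))) has_derivative integral {0..1} (Dz z)) (at z)"
    if "z \<in> V \<times> V" for z
    using leibniz [OF that] unfolding at_within_open [OF that op] box_real .
  \<comment> \<open>Evaluated at \<open>dz\<close> and expanded over the basis, the operator-valued
    integral becomes a sum of integrals of the original type, with weights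
    \<open>c t * (s dz t \<bullet> b)\<close>.\<close>
  have "Ck_on k UNIV (V \<times> V) (\<lambda>z. integral {0..1} (Dz z) dz)" for dz
  proof -
    have "Ck_on k UNIV (V \<times> V)
        (\<lambda>z. \<Sum>b\<in>Basis. integral {0..1} (\<lambda>t. (c t * (s dz t \<bullet> b)) * h' (fst z + t *\<^sub>R (snd z - fst z)) b))"
      by (intro Ck_on_sum op Suc.IH h' cont_c)
    then show ?thesis
    proof (rule Ck_on_cong [OF op, rotated])
      fix z assume z: "z \<in> V \<times> V"
      have "continuous_on {0..1} (\<lambda>t. (\<lambda>(z, t). Dz z t) (z, t))"
        by (rule continuous_on_compose2 [OF cont_D]) (use z in \<open>auto intro!: continuous_intros\<close>)
      then have "Dz z integrable_on {0..1}"
        by (auto intro!: integrable_continuous_real)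
      then have "integral {0..1} (Dz z) dz = integral {0..1} (\<lambda>t. Dz z t dz)"
        by (rule blinfun_apply_integral)
      also have "\<dots> = integral {0..1} (\<lambda>t. \<Sum>b\<in>Basis. (c t * (s dz t \<bullet> b)) * h' (s z t) b)"
        by (rule integral_cong) (simp only: Dz [OF z] h'_sum [OF z])
      also have "\<dots> = (\<Sum>b\<in>Basis. integral {0..1} (\<lambda>t. (c t * (s dz t \<bullet> b)) * h' (s z t) b))"
      proof (rule integral_sum)
        fix b :: 'b
        have "continuous_on {0..1} (\<lambda>t. (\<lambda>(z, t). (c t * (s dz t \<bullet> b)) * h' (s z t) b) (z, t))"
          by (rule continuous_on_compose2 [OF cont_b]) (use z in \<open>auto intro!: continuous_intros\<close>)
        then show "(\<lambda>t. (c t * (s dz t \<bullet> b)) * h' (s z t) b) integrable_on {0..1}"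
          by (auto intro!: integrable_continuous_real)
      qed auto
      finally show "(\<Sum>b\<in>Basis. integral {0..1} (\<lambda>t. (c t * (s dz t \<bullet> b)) * h' (fst z + t *\<^sub>R (snd z - fst z)) b)) = integral {0..1} (Dz z) dz"
        by (simp add: s_def)
    qed
  qed
  then show ?case
    using deriv unfolding s_def by (intro Ck_on_SucI [OF op])
qed

lemma Ck_on_Pair:
  assumes "open U" "Ck_on k UNIV U f" "Ck_on k UNIV U g"
  shows "Ck_on k UNIV U (\<lambda>x. (f x, g x))"
proof -
  have "Ck_on k UNIV U (\<lambda>x. (f x, 0) + (0, g x))"
    by (intro Ck_on_add assms Ck_on_bounded_linear [OF assms(1), where L = "\<lambda>u. (u, 0)"]
        Ck_on_bounded_linear [OF assms(1), where L = "\<lambda>u. (0, u)"] bounded_linear_intros)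
  then show ?thesis by simp
qed

lemma Ck_on_segment_integral:
  fixes h :: "'b::euclidean_space \<Rightarrow> real"
  assumes "open V" "convex V" "Ck_on k UNIV V h" "continuous_on {0..1} c"
    and "open U" "Ck_on k UNIV U a" "Ck_on k UNIV U b" "a ` U \<subseteq> V" "b ` U \<subseteq> V"
  shows "Ck_on k UNIV U (\<lambda>x. integral {0..1} (\<lambda>t. c t * h (a x + t *\<^sub>R (b x - a x))))"
  using Ck_on_compose [OF assms(5) _ Ck_on_segment_integral_pair [OF assms(1-4)] Ck_on_Pair [OF assms(5-7)]]
    assms by (auto simp: open_Times image_subset_iff)

section \<open>Cholesky factorisation with \<open>C\<^sup>k\<close> dependence\<close>

text \<open>Completing the square in the last variable; the matrix \<open>B\<close> below is the Schur complement.\<close>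

lemma Ck_on_cholesky:
  fixes A :: "nat \<Rightarrow> nat \<Rightarrow> 'a::real_normed_vector \<Rightarrow> real"
  assumes "open U" "x0 \<in> U"
    and "\<And>i j. i < r \<Longrightarrow> j < r \<Longrightarrow> Ck_on k UNIV U (A i j)"
    and "\<And>i j x. i < r \<Longrightarrow> j < r \<Longrightarrow> x \<in> U \<Longrightarrow> A i j x = A j i x"
    and "\<And>w. \<exists>i<r. w i \<noteq> 0 \<Longrightarrow> 0 < (\<Sum>i<r. \<Sum>j<r. A i j x0 * w i * w j)"
  shows "\<exists>V L. open V \<and> x0 \<in> V \<and> V \<subseteq> U \<and> (\<forall>i<r. \<forall>j<r. Ck_on k UNIV V (L i j)) \<and>
    (\<forall>x\<in>V. \<forall>w. (\<Sum>i<r. \<Sum>j<r. A i j x * w i * w j) = (\<Sum>i<r. (\<Sum>j<r. L i j x * w j)\<^sup>2))"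
  using assms
proof (induction r arbitrary: U A)
  case 0
  then show ?case by auto
next
  case (Suc r)
  note symm = Suc.prems(4)
  \<comment> \<open>The last unit vector as test vector shows that the pivot is positive at
    \<open>x0\<close>; \<open>V1\<close> is the open set where it stays positive and may be divided
    by.\<close>
  have a0: "A r r x0 > 0"
    using Suc.prems(5) [of "\<lambda>i. if i = r then 1 else 0"] by (simp add: if_distrib cong: if_cong)
  define V1 where "V1 = U \<inter> A r r -` {0<..}"
  have V1: "open V1" "x0 \<in> V1" "V1 \<subseteq> U"
    using a0 Suc.prems(1,2) continuous_open_preimage
      [OF Ck_on_imp_continuous_on [OF Suc.prems(3) [of r r]] Suc.prems(1)]
    by (auto simp: V1_def)
  have AV: "Ck_on k UNIV V1 (A i j)" if "i < Suc r" "j < Suc r" for i j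
    using Suc.prems(3) [OF that] V1(3) by (auto intro: Ck_on_mono)
  have pos: "A r r x > 0" if "x \<in> V1" for x using that by (simp add: V1_def)
  define B where "B i j x = A i j x - A r i x * A r j x / A r r x" for i j x
  have square: "(\<Sum>i<Suc r. \<Sum>j<Suc r. A i j x * w i * w j) =
      (\<Sum>i<r. \<Sum>j<r. B i j x * w i * w j) + A r r x * (w r + (\<Sum>j<r. A r j x * w j) / A r r x)\<^sup>2"
    if x: "x \<in> V1" for x w
  proof -
    define s where "s = (\<Sum>j<r. A r j x * w j)"
    have "(\<Sum>i<r. A i r x * w i * w r) = s * w r"
      unfolding s_def sum_distrib_right
    proof (intro sum.cong refl)
      fix i assume "i \<in> {..<r}"
      then have "A i r x = A r i x" using symm [of i r x] x V1(3) by auto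
      then show "A i r x * w i * w r = A r i x * w i * w r" by simp
    qed
    moreover have "(\<Sum>j<r. A r j x * w r * w j) = s * w r"
      unfolding s_def sum_distrib_right by (intro sum.cong) auto
    ultimately have 1: "(\<Sum>i<Suc r. \<Sum>j<Suc r. A i j x * w i * w j) =
        (\<Sum>i<r. \<Sum>j<r. A i j x * w i * w j) + 2 * s * w r + A r r x * (w r)\<^sup>2"
      by (simp add: sum.distrib power2_eq_square)
    have "(\<Sum>i<r. \<Sum>j<r. A r i x * A r j x / A r r x * w i * w j) = s * s / A r r x"
      unfolding s_def sum_product sum_divide_distrib by (intro sum.cong) auto
    then have 2: "(\<Sum>i<r. \<Sum>j<r. B i j x * w i * w j) = (\<Sum>i<r. \<Sum>j<r. A i j x * w i * w j) - s * s / A r r x"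
      by (simp add: B_def left_diff_distrib sum_subtractf)
    show ?thesis
      unfolding 1 2 s_def [symmetric]
      using pos [OF x] by (simp add: field_simps power2_eq_square)
  qed
  have "\<exists>V L. open V \<and> x0 \<in> V \<and> V \<subseteq> V1 \<and> (\<forall>i<r. \<forall>j<r. Ck_on k UNIV V (L i j)) \<and>
    (\<forall>x\<in>V. \<forall>w. (\<Sum>i<r. \<Sum>j<r. B i j x * w i * w j) = (\<Sum>i<r. (\<Sum>j<r. L i j x * w j)\<^sup>2))"
  proof (rule Suc.IH)
    show "Ck_on k UNIV V1 (B i j)" if "i < r" "j < r" for i j
      unfolding B_def using that pos
      by (intro Ck_on_diff Ck_on_divide_nonzero Ck_on_mult AV V1) force+
    show "B i j x = B j i x" if "i < r" "j < r" "x \<in> V1" for i j x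
      using that symm [of i j x] V1(3) by (auto simp: B_def)
    show "0 < (\<Sum>i<r. \<Sum>j<r. B i j x0 * w i * w j)" if w: "\<exists>i<r. w i \<noteq> 0" for w
    proof -
      \<comment> \<open>The last coordinate is chosen to make the completed square vanish, so
        positivity of \<open>A\<close> at \<open>w'\<close> is positivity of \<open>B\<close> at
        \<open>w\<close>.\<close>
      define w' where "w' = w(r := - (\<Sum>j<r. A r j x0 * w j) / A r r x0)"
      have w'w: "w' i = w i" if "i < r" for i using that by (simp add: w'_def)
      have "\<exists>i<Suc r. w' i \<noteq> 0" using w w'w by (metis less_Suc_eq)
      then have "0 < (\<Sum>i<Suc r. \<Sum>j<Suc r. A i j x0 * w' i * w' j)"
        by (rule Suc.prems(5))
      also have "\<dots> = (\<Sum>i<r. \<Sum>j<r. B i j x0 * w i * w j) +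
          A r r x0 * (w' r + (\<Sum>j<r. A r j x0 * w j) / A r r x0)\<^sup>2"
        unfolding square [OF V1(2)] by (simp add: w'w)
      also have "\<dots> = (\<Sum>i<r. \<Sum>j<r. B i j x0 * w i * w j)"
        by (simp add: w'_def)
      finally show ?thesis .
    qed
  qed (use V1 in auto)
  then obtain V L where V: "open V" "x0 \<in> V" "V \<subseteq> V1"
    and L: "\<forall>i<r. \<forall>j<r. Ck_on k UNIV V (L i j)"
    and Leq: "\<forall>x\<in>V. \<forall>w. (\<Sum>i<r. \<Sum>j<r. B i j x * w i * w j) = (\<Sum>i<r. (\<Sum>j<r. L i j x * w j)\<^sup>2)"
    by (elim exE conjE) (rule that)
  \<comment> \<open>The rows below \<open>r\<close> come from the induction hypothesis, padded by a
    zero in the last column; row \<open>r\<close> is the completed square with the root of the pivot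
    multiplied in.\<close>
  define L' where "L' i j x = (if i < r then (if j < r then L i j x else 0)
      else (if j < r then A r j x / sqrt (A r r x) else sqrt (A r r x)))" for i j x
  have sq: "Ck_on k UNIV V (\<lambda>x. sqrt (A r r x))"
    by (rule Ck_on_compose [OF V(1) _ Ck_on_sqrt Ck_on_mono [OF AV]]) (use V(3) pos in auto)
  have "Ck_on k UNIV V (L' i j)" if "i < Suc r" "j < Suc r" for i j
  proof -
    have "Ck_on k UNIV V (\<lambda>x. A r j x / sqrt (A r r x))"
      using pos V(3) by (intro Ck_on_divide_nonzero sq V Ck_on_mono [OF AV]) (use that in force)+
    then show ?thesis
      using L sq Ck_on_const [OF V(1), of k "0::real"]
      by (cases "i < r"; cases "j < r") (simp_all add: L'_def [abs_def])
  qed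
  moreover have "(\<Sum>i<Suc r. \<Sum>j<Suc r. A i j x * w i * w j) = (\<Sum>i<Suc r. (\<Sum>j<Suc r. L' i j x * w j)\<^sup>2)"
    if x: "x \<in> V" for x w
  proof -
    have p: "A r r x > 0" using x V(3) pos by auto
    define s where "s = (\<Sum>j<r. A r j x * w j)"
    have "(\<Sum>j<Suc r. L' r j x * w j) = s / sqrt (A r r x) + sqrt (A r r x) * w r"
      by (simp add: L'_def s_def sum_divide_distrib)
    also have "\<dots> = sqrt (A r r x) * (w r + s / A r r x)"
      using p by (simp add: field_simps)
    finally have "(\<Sum>j<Suc r. L' r j x * w j)\<^sup>2 = A r r x * (w r + s / A r r x)\<^sup>2"
      using p by (simp add: power_mult_distrib)
    moreover have "(\<Sum>i<r. (\<Sum>j<Suc r. L' i j x * w j)\<^sup>2) = (\<Sum>i<r. (\<Sum>j<r. L i j x * w j)\<^sup>2)"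
      by (intro sum.cong) (auto simp: L'_def)
    ultimately show ?thesis
      using square [of x w] Leq x V(3) by (auto simp: s_def)
  qed
  ultimately show ?case
    using V V1 by (intro exI [of _ V] exI [of _ L']) auto
qed

section \<open>Second derivatives\<close>

lemma has_derivative_iter_deriv:
  assumes "Ck_on 2 UNIV \<Omega> f" "x \<in> \<Omega>"
  shows "(f has_derivative frechet_derivative f (at x)) (at x)"
    and "((\<lambda>y. frechet_derivative f (at y) v) has_derivative (\<lambda>u. iter_deriv UNIV [u, v] f x)) (at x)"
proof -
  have "Ck_on (Suc (Suc 0)) UNIV \<Omega> f" using assms(1) by (simp add: numeral_2_eq_2)
  then have "f differentiable at x" "(\<lambda>y. frechet_derivative f (at y) v) differentiable at x"
    using assms(2) by (auto simp: Ck_on_Suc)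
  then show "(f has_derivative frechet_derivative f (at x)) (at x)"
    and "((\<lambda>y. frechet_derivative f (at y) v) has_derivative (\<lambda>u. iter_deriv UNIV [u, v] f x)) (at x)"
    by (simp_all add: frechet_derivative_works)
qed

lemma Ck_on_iter_deriv2:
  assumes "Ck_on (Suc (Suc k)) UNIV \<Omega> f"
  shows "Ck_on k UNIV \<Omega> (iter_deriv UNIV [u, v] f)"
  using assms by (simp add: Ck_on_Suc)

lemma has_derivative_along_line:
  fixes g :: "'a::real_normed_vector \<Rightarrow> real"
  assumes "(g has_derivative D) (at (x + s *\<^sub>R u))"
  shows "((\<lambda>s. g (x + s *\<^sub>R u)) has_real_derivative D u) (at s)"
proof -
  have "((\<lambda>s. x + s *\<^sub>R u) has_derivative (\<lambda>s. s *\<^sub>R u)) (at s)"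
    by (auto intro!: derivative_eq_intros)
  from has_derivative_compose [OF this assms]
  have "((\<lambda>s. g (x + s *\<^sub>R u)) has_derivative (\<lambda>t. D (t *\<^sub>R u))) (at s)" .
  moreover have "(\<lambda>t. D (t *\<^sub>R u)) = (*) (D u)"
    using has_derivative_linear [OF assms] by (auto simp: linear_cmul)
  ultimately show ?thesis by (simp add: has_field_derivative_def)
qed

text \<open>Two applications of the mean value theorem: along \<open>u\<close> to the increment of
  \<open>f\<close> by \<open>h *\<^sub>R v\<close>, then along \<open>v\<close> to the derivative in
  direction \<open>u\<close>.\<close>

lemma second_difference_mean_value:
  fixes f :: "'a::real_normed_vector \<Rightarrow> real"
  assumes "Ck_on 2 UNIV \<Omega> f" "h > 0"
    and in\<Omega>: "\<And>s t. 0 \<le> s \<Longrightarrow> s \<le> h \<Longrightarrow> 0 \<le> t \<Longrightarrow> t \<le> h \<Longrightarrow> x + s *\<^sub>R u + t *\<^sub>R v \<in> \<Omega>"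
  shows "\<exists>s t. 0 \<le> s \<and> s \<le> h \<and> 0 \<le> t \<and> t \<le> h \<and>
    f (x + h *\<^sub>R u + h *\<^sub>R v) - f (x + h *\<^sub>R u) - f (x + h *\<^sub>R v) + f x =
      h * h * iter_deriv UNIV [v, u] f (x + s *\<^sub>R u + t *\<^sub>R v)"
proof -
  define d where "d s = frechet_derivative f (at (x + h *\<^sub>R v + s *\<^sub>R u)) u - frechet_derivative f (at (x + s *\<^sub>R u)) u" for s
  have "((\<lambda>s. f (x + h *\<^sub>R v + s *\<^sub>R u) - f (x + s *\<^sub>R u)) has_real_derivative d s) (at s)"
    if "0 \<le> s" "s \<le> h" for s
  proof -
    have "x + h *\<^sub>R v + s *\<^sub>R u \<in> \<Omega>" using in\<Omega> [of s h] that assms(2) by (simp add: algebra_simps)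
    moreover have "x + s *\<^sub>R u \<in> \<Omega>" using in\<Omega> [of s 0] that assms(2) by simp
    ultimately show ?thesis
      unfolding d_def
      using has_derivative_along_line [OF has_derivative_iter_deriv(1) [OF assms(1)]]
      by (intro DERIV_diff) auto
  qed
  from MVT2 [OF assms(2) this] obtain s where s: "0 < s" "s < h"
    and 1: "(f (x + h *\<^sub>R v + h *\<^sub>R u) - f (x + h *\<^sub>R u)) - (f (x + h *\<^sub>R v) - f x) = h * d s"
    by auto
  have "((\<lambda>t. frechet_derivative f (at (x + s *\<^sub>R u + t *\<^sub>R v)) u) has_real_derivative
      iter_deriv UNIV [v, u] f (x + s *\<^sub>R u + t *\<^sub>R v)) (at t)" if "0 \<le> t" "t \<le> h" for t
    by (rule has_derivative_along_line [OF has_derivative_iter_deriv(2) [OF assms(1)]])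
      (use in\<Omega> s that in auto)
  from MVT2 [OF assms(2) this] obtain t where t: "0 < t" "t < h"
    and 2: "frechet_derivative f (at (x + s *\<^sub>R u + h *\<^sub>R v)) u - frechet_derivative f (at (x + s *\<^sub>R u)) u
      = h * iter_deriv UNIV [v, u] f (x + s *\<^sub>R u + t *\<^sub>R v)"
    by auto
  have "x + s *\<^sub>R u + h *\<^sub>R v = x + h *\<^sub>R v + s *\<^sub>R u" by simp
  with 2 have "d s = h * iter_deriv UNIV [v, u] f (x + s *\<^sub>R u + t *\<^sub>R v)"
    by (simp only: d_def)
  with 1 have "f (x + h *\<^sub>R v + h *\<^sub>R u) - f (x + h *\<^sub>R u) - f (x + h *\<^sub>R v) + f x =
      h * h * iter_deriv UNIV [v, u] f (x + s *\<^sub>R u + t *\<^sub>R v)"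
    by (simp del: iter_deriv.simps)
  moreover have "x + h *\<^sub>R u + h *\<^sub>R v = x + h *\<^sub>R v + h *\<^sub>R u" by simp
  ultimately have "f (x + h *\<^sub>R u + h *\<^sub>R v) - f (x + h *\<^sub>R u) - f (x + h *\<^sub>R v) + f x =
      h * h * iter_deriv UNIV [v, u] f (x + s *\<^sub>R u + t *\<^sub>R v)"
    by (simp only:)
  with s t show ?thesis
    by (meson less_imp_le)
qed

text \<open>The second difference does not change when \<open>u\<close> and \<open>v\<close> are
  exchanged, so both mixed derivatives take a common value at points arbitrarily close to
  \<open>x\<close>; continuity does the rest.\<close>

lemma iter_deriv_symmetric:
  fixes f :: "'a::real_normed_vector \<Rightarrow> real"
  assumes "open \<Omega>" "Ck_on 2 UNIV \<Omega> f" "x \<in> \<Omega>"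
  shows "iter_deriv UNIV [u, v] f x = iter_deriv UNIV [v, u] f x"
proof -
  let ?a = "iter_deriv UNIV [u, v] f" and ?b = "iter_deriv UNIV [v, u] f"
  have "dist (?a x) (?b x) < e" if e: "e > 0" for e
  proof -
    have cont: "isCont ?a x" "isCont ?b x"
      using assms Ck_on_imp_continuous_on [OF Ck_on_iter_deriv2 [of 0 \<Omega> f]]
      by (auto simp: continuous_on_eq_continuous_at numeral_2_eq_2 simp del: iter_deriv.simps)
    obtain r1 where r1: "r1 > 0" "\<And>y. dist y x < r1 \<Longrightarrow> dist (?a y) (?a x) < e / 2"
      using cont(1) [unfolded continuous_at_eps_delta, rule_format, OF half_gt_zero [OF e]]
      by blast
    obtain r2 where r2: "r2 > 0" "\<And>y. dist y x < r2 \<Longrightarrow> dist (?b y) (?b x) < e / 2"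
      using cont(2) [unfolded continuous_at_eps_delta, rule_format, OF half_gt_zero [OF e]]
      by blast
    obtain r3 where r3: "r3 > 0" "ball x r3 \<subseteq> \<Omega>"
      using assms open_contains_ball by blast
    define r where "r = min r1 (min r2 r3)"
    \<comment> \<open>Small enough to keep the whole parallelogram within distance \<open>r\<close>
      of \<open>x\<close>; the summand 1 keeps the denominator positive when both directions are
      zero.\<close>
    define h where "h = r / (2 * (norm u + norm v + 1))"
    have r: "r > 0" using r1 r2 r3 by (simp add: r_def)
    then have h: "h > 0" by (simp add: h_def add_nonneg_pos)
    have near: "dist (x + s *\<^sub>R u + t *\<^sub>R v) x < r" if "0 \<le> s" "s \<le> h" "0 \<le> t" "t \<le> h" for s t
    proof -
      have "dist (x + s *\<^sub>R u + t *\<^sub>R v) x = norm (s *\<^sub>R u + t *\<^sub>R v)"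
        by (simp add: dist_norm)
      also have "\<dots> \<le> s * norm u + t * norm v"
        using norm_triangle_ineq [of "s *\<^sub>R u" "t *\<^sub>R v"] that by simp
      also have "\<dots> \<le> h * norm u + h * norm v"
        using that by (intro add_mono mult_right_mono) auto
      also have "\<dots> < h * (2 * (norm u + norm v + 1))"
        using h by (simp add: distrib_left add_nonneg_pos)
      also have "\<dots> = r"
      proof -
        have "norm u + norm v + 1 \<noteq> 0" by (smt (verit) norm_ge_zero)
        then show ?thesis by (simp add: h_def)
      qed
      finally show ?thesis .
    qed
    have in1: "x + s *\<^sub>R u + t *\<^sub>R v \<in> \<Omega>" if "0 \<le> s" "s \<le> h" "0 \<le> t" "t \<le> h" for s t
      using near [OF that] r3(2) by (auto simp: r_def dist_commute subset_iff)
    have in2: "x + s *\<^sub>R v + t *\<^sub>R u \<in> \<Omega>" if "0 \<le> s" "s \<le> h" "0 \<le> t" "t \<le> h" for s t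
      using in1 [of t s] that by (simp add: algebra_simps)
    obtain s t where st: "0 \<le> s" "s \<le> h" "0 \<le> t" "t \<le> h" and
      1: "f (x + h *\<^sub>R u + h *\<^sub>R v) - f (x + h *\<^sub>R u) - f (x + h *\<^sub>R v) + f x =
        h * h * ?b (x + s *\<^sub>R u + t *\<^sub>R v)"
      using second_difference_mean_value [OF assms(2) h in1] by blast
    obtain s' t' where st': "0 \<le> s'" "s' \<le> h" "0 \<le> t'" "t' \<le> h" and
      2: "f (x + h *\<^sub>R v + h *\<^sub>R u) - f (x + h *\<^sub>R v) - f (x + h *\<^sub>R u) + f x =
        h * h * ?a (x + s' *\<^sub>R v + t' *\<^sub>R u)"
      using second_difference_mean_value [OF assms(2) h in2] by blast
    have comm: "x + h *\<^sub>R v + h *\<^sub>R u = x + h *\<^sub>R u + h *\<^sub>R v"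
      "x + s' *\<^sub>R v + t' *\<^sub>R u = x + t' *\<^sub>R u + s' *\<^sub>R v" by simp_all
    have "h * h * ?a (x + t' *\<^sub>R u + s' *\<^sub>R v) = h * h * ?b (x + s *\<^sub>R u + t *\<^sub>R v)"
      using 1 2 unfolding comm by linarith
    then have "?a (x + t' *\<^sub>R u + s' *\<^sub>R v) = ?b (x + s *\<^sub>R u + t *\<^sub>R v)"
      using h by (simp del: iter_deriv.simps)
    moreover have "dist (?a (x + t' *\<^sub>R u + s' *\<^sub>R v)) (?a x) < e / 2"
      using near [of t' s'] st' by (intro r1) (auto simp: r_def)
    moreover have "dist (?b (x + s *\<^sub>R u + t *\<^sub>R v)) (?b x) < e / 2"
      using near [of s t] st by (intro r2) (auto simp: r_def)
    ultimately show ?thesis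
      by (metis dist_commute dist_triangle_half_r)
  qed
  then show ?thesis by (metis dist_self less_irrefl zero_less_dist_iff)
qed

text \<open>The outer direction enters through a derivative, hence linearly; symmetry carries this
  over to the inner one.\<close>

lemma linear_iter_deriv2:
  fixes f :: "'a::real_normed_vector \<Rightarrow> real"
  assumes "open \<Omega>" "Ck_on 2 UNIV \<Omega> f" "x \<in> \<Omega>"
  shows "linear (\<lambda>u. iter_deriv UNIV [u, v] f x)" "linear (\<lambda>v. iter_deriv UNIV [u, v] f x)"
proof -
  show l: "linear (\<lambda>u. iter_deriv UNIV [u, v] f x)" for v
    using has_derivative_linear [OF has_derivative_iter_deriv(2) [OF assms(2,3)]] .
  show "linear (\<lambda>v. iter_deriv UNIV [u, v] f x)"
    unfolding iter_deriv_symmetric [OF assms, of u] by (rule l)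
qed

text \<open>The bridge between the matrix, defined by coordinate directions, and second derivatives
  in arbitrary directions: both sides are bilinear.\<close>

lemma inner_hessian:
  assumes "open \<Omega>" "Ck_on 2 UNIV \<Omega> f" "x \<in> \<Omega>"
  shows "u \<bullet> (hessian f x *v v) = iter_deriv UNIV [u, v] f x"
proof -
  note lin = linear_iter_deriv2 [OF assms]
  have basis: "g w = (\<Sum>i\<in>UNIV. w $ i * g (axis i 1))" if "linear g" for g :: "real^'n \<Rightarrow> real" and w
  proof -
    have "g w = g (\<Sum>i\<in>UNIV. w $ i *s axis i 1)"
      by (simp add: basis_expansion)
    then show ?thesis
      by (simp add: linear_sum [OF that] linear_cmul [OF that] scalar_mult_eq_scaleR)
  qed
  have "iter_deriv UNIV [u, v] f x = (\<Sum>i\<in>UNIV. u $ i * iter_deriv UNIV [axis i 1, v] f x)"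
    using basis [OF lin(1)] .
  also have "\<dots> = (\<Sum>i\<in>UNIV. u $ i * (\<Sum>j\<in>UNIV. v $ j * iter_deriv UNIV [axis i 1, axis j 1] f x))"
    by (intro sum.cong refl arg_cong2 [where f = "(*)"] basis [OF lin(2)])
  finally show ?thesis
    by (simp add: inner_vec_def hessian_def matrix_vector_mult_def mult.commute del: iter_deriv.simps)
qed

lemma frechet_derivative_zero_at_min:
  fixes f :: "'a::real_normed_vector \<Rightarrow> real"
  assumes "open \<Omega>" "Ck_on 2 UNIV \<Omega> f" "x \<in> \<Omega>" "\<And>y. y \<in> \<Omega> \<Longrightarrow> f x \<le> f y"
  shows "frechet_derivative f (at x) = (\<lambda>_. 0)"
proof (rule has_derivative_local_min [OF has_derivative_iter_deriv(1) [OF assms(2,3)]])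
  show "eventually (\<lambda>y. f x \<le> f y) (at x)"
    using eventually_at_in_open' [OF assms(1,3)] by eventually_elim (rule assms(4))
qed

text \<open>If the second derivative were negative, the slope \<open>g\<close>, zero at the minimum,
  would be negative just to the right of it, and by the mean value theorem \<open>f\<close> would
  fall below its minimum.\<close>

lemma iter_deriv2_nonneg_at_min:
  fixes f :: "'a::real_normed_vector \<Rightarrow> real"
  assumes "open \<Omega>" "Ck_on 2 UNIV \<Omega> f" "x \<in> \<Omega>" "\<And>y. y \<in> \<Omega> \<Longrightarrow> f x \<le> f y"
  shows "0 \<le> iter_deriv UNIV [v, v] f x"
proof (rule ccontr)
  assume neg: "\<not> ?thesis"
  define g where "g s = frechet_derivative f (at (x + s *\<^sub>R v)) v" for s
  have "(g has_real_derivative iter_deriv UNIV [v, v] f x) (at 0)"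
    unfolding g_def
    by (rule has_derivative_along_line) (use has_derivative_iter_deriv(2) [OF assms(2,3)] in simp)
  from DERIV_neg_dec_right [OF this] neg obtain d where d: "d > 0"
    "\<And>h. 0 < h \<Longrightarrow> h < d \<Longrightarrow> g h < g 0"
    by (auto simp del: iter_deriv.simps)
  have g0: "g 0 = 0"
    using frechet_derivative_zero_at_min [OF assms] by (simp add: g_def)
  have "open ((\<lambda>s::real. x + s *\<^sub>R v) -` \<Omega>)"
    by (intro open_vimage assms continuous_intros)
  moreover have "0 \<in> (\<lambda>s::real. x + s *\<^sub>R v) -` \<Omega>" using assms(3) by simp
  ultimately obtain d' where d': "d' > 0" "ball 0 d' \<subseteq> (\<lambda>s::real. x + s *\<^sub>R v) -` \<Omega>"
    by (rule openE)
  define h where "h = min d d' / 2"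
  have h: "0 < h" "h < d" "h < d'" using d(1) d'(1) by (auto simp: h_def)
  have in\<Omega>: "x + s *\<^sub>R v \<in> \<Omega>" if "0 \<le> s" "s \<le> h" for s
    using d'(2) that h by (auto simp: subset_iff)
  have "((\<lambda>s. f (x + s *\<^sub>R v)) has_real_derivative g s) (at s)" if "0 \<le> s" "s \<le> h" for s
    unfolding g_def
    by (rule has_derivative_along_line [OF has_derivative_iter_deriv(1) [OF assms(2) in\<Omega> [OF that]]])
  from MVT2 [OF h(1) this] obtain s where s: "0 < s" "s < h" "f (x + h *\<^sub>R v) - f x = h * g s"
    by auto
  then have "f (x + h *\<^sub>R v) < f x"
    using d(2) [of s] g0 h by (smt (verit) mult_pos_neg)
  then show False
    using assms(4) [OF in\<Omega> [of h]] h by simp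
qed

text \<open>Integration by parts packaged into the antiderivative
  \<open>(1 - t) * g t + f (q + t *\<^sub>R (x - q))\<close>. It equals \<open>f x\<close> at 1, and
  vanishes at 0 because \<open>q\<close> is a critical zero.\<close>

lemma taylor_integral_remainder:
  fixes f :: "'a::real_normed_vector \<Rightarrow> real"
  assumes "convex V" "Ck_on 2 UNIV V f" "q \<in> V" "x \<in> V"
    and "f q = 0" "frechet_derivative f (at q) = (\<lambda>_. 0)"
  shows "((\<lambda>t. (1 - t) * iter_deriv UNIV [x - q, x - q] f (q + t *\<^sub>R (x - q))) has_integral f x) {0..1}"
proof -
  define g where "g t = frechet_derivative f (at (q + t *\<^sub>R (x - q))) (x - q)" for t
  have inV: "q + t *\<^sub>R (x - q) \<in> V" if "t \<in> {0..1}" for t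
  proof -
    have "(1 - t) *\<^sub>R q + t *\<^sub>R x \<in> V"
      using convexD_alt [OF assms(1,3,4)] that by auto
    then show ?thesis by (simp add: algebra_simps)
  qed
  have g: "(g has_real_derivative iter_deriv UNIV [x - q, x - q] f (q + t *\<^sub>R (x - q))) (at t)"
    if "t \<in> {0..1}" for t
    unfolding g_def
    by (rule has_derivative_along_line [OF has_derivative_iter_deriv(2) [OF assms(2) inV [OF that]]])
  have f: "((\<lambda>t. f (q + t *\<^sub>R (x - q))) has_real_derivative g t) (at t)" if "t \<in> {0..1}" for t
    unfolding g_def
    by (rule has_derivative_along_line [OF has_derivative_iter_deriv(1) [OF assms(2) inV [OF that]]])
  have "((\<lambda>t. (1 - t) * g t + f (q + t *\<^sub>R (x - q))) has_real_derivative
      (1 - t) * iter_deriv UNIV [x - q, x - q] f (q + t *\<^sub>R (x - q))) (at t)" if "t \<in> {0..1}" for t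
    by (rule derivative_eq_intros refl f [OF that] g [OF that])+ simp
  then have "((\<lambda>t. (1 - t) * iter_deriv UNIV [x - q, x - q] f (q + t *\<^sub>R (x - q))) has_integral
      ((1 - 1) * g 1 + f (q + 1 *\<^sub>R (x - q))) - ((1 - 0) * g 0 + f (q + 0 *\<^sub>R (x - q)))) {0..1}"
    by (intro fundamental_theorem_of_calculus)
      (auto simp: has_real_derivative_iff_has_vector_derivative [symmetric] simp del: iter_deriv.simps
        intro: has_field_derivative_at_within)
  then show ?thesis
    using assms by (simp add: g_def del: iter_deriv.simps)
qed

section \<open>Submanifolds\<close>

lemma submanifoldE:
  fixes N :: "(real^'n) set"
  assumes "submanifold k m N" "x \<in> N"
  obtains S U' V and \<phi> \<psi> :: "real^'n \<Rightarrow> real^'n" where "subspace S" "dim S = m"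
    "openin (top_of_set S) U'" "0 \<in> U'" "open V" "Ck_on k S U' \<phi>" "\<phi> 0 = x" "\<phi> ` U' = N \<inter> V"
    "homeomorphism U' (\<phi> ` U') \<phi> \<psi>" "inj_on (frechet_derivative \<phi> (at 0 within S)) S"
  using bspec [OF assms(1) [unfolded submanifold_def] assms(2)]
  by (elim exE conjE) (rule that, assumption+)

lemma submanifoldI:
  fixes N :: "(real^'n) set"
  assumes "\<And>x. x \<in> N \<Longrightarrow> \<exists>S U' V \<phi> \<psi>. subspace S \<and> dim S = m \<and>
    openin (top_of_set S) U' \<and> 0 \<in> U' \<and> open V \<and> Ck_on k S U' (\<phi> :: real^'n \<Rightarrow> real^'n) \<and>
    \<phi> 0 = x \<and> \<phi> ` U' = N \<inter> V \<and> homeomorphism U' (\<phi> ` U') \<phi> \<psi> \<and>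
    inj_on (frechet_derivative \<phi> (at 0 within S)) S"
  shows "submanifold k m N"
  unfolding submanifold_def
proof
  fix x assume "x \<in> N"
  from assms [OF this] show "\<exists>S U' V \<phi>. subspace S \<and> dim S = m \<and>
        openin (top_of_set S) U' \<and> 0 \<in> U' \<and> open V \<and>
        Ck_on k S U' (\<phi> :: real^'n \<Rightarrow> real^'n) \<and> \<phi> 0 = x \<and> \<phi> ` U' = N \<inter> V \<and>
        (\<exists>\<psi>. homeomorphism U' (\<phi> ` U') \<phi> \<psi>) \<and>
        inj_on (frechet_derivative \<phi> (at 0 within S)) S"
    by (elim exE conjE) (intro exI conjI, assumption+)
qed

text \<open>Each chart is cut down to the part of its domain that it maps into
  \<open>V'\<close>.\<close>

lemma submanifold_Int_open:
  fixes N :: "(real^'n) set"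
  assumes "submanifold k m N" "open V'"
  shows "submanifold k m (N \<inter> V')"
proof (rule submanifoldI)
  fix x assume x: "x \<in> N \<inter> V'"
  obtain S U' V and \<phi> \<psi> :: "real^'n \<Rightarrow> real^'n" where c: "subspace S" "dim S = m"
    "openin (top_of_set S) U'" "0 \<in> U'" "open V" "Ck_on k S U' \<phi>" "\<phi> 0 = x" "\<phi> ` U' = N \<inter> V"
    "homeomorphism U' (\<phi> ` U') \<phi> \<psi>" "inj_on (frechet_derivative \<phi> (at 0 within S)) S"
    by (rule submanifoldE [OF assms(1) IntD1 [OF x]])
  define U2 where "U2 = U' \<inter> \<phi> -` V'"
  have "openin (top_of_set U') U2"
    unfolding U2_def
    by (rule continuous_openin_preimage_gen [OF Ck_on_imp_continuous_on [OF c(6)] assms(2)])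
  then have "openin (top_of_set S) U2"
    using c(3) openin_trans by blast
  moreover have "\<phi> ` U2 = \<phi> ` U' \<inter> V'"
    by (auto simp: U2_def)
  then have "0 \<in> U2" "\<phi> ` U2 = N \<inter> V' \<inter> (V \<inter> V')" "U2 \<subseteq> U'"
    using c x by (auto simp: U2_def)
  moreover have "homeomorphism U2 (\<phi> ` U2) \<phi> \<psi>"
    using homeomorphism_of_subsets [OF c(9)] \<open>U2 \<subseteq> U'\<close> by blast
  moreover have "Ck_on k S U2 \<phi>"
    using Ck_on_mono [OF c(6)] \<open>U2 \<subseteq> U'\<close> by blast
  moreover have "open (V \<inter> V')" using c assms by blast
  ultimately show "\<exists>S U' V \<phi> \<psi>. subspace S \<and> dim S = m \<and> openin (top_of_set S) U' \<and> 0 \<in> U' \<and> open V \<and>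
        Ck_on k S U' (\<phi> :: real^'n \<Rightarrow> real^'n) \<and> \<phi> 0 = x \<and> \<phi> ` U' = N \<inter> V' \<inter> V \<and>
        homeomorphism U' (\<phi> ` U') \<phi> \<psi> \<and> inj_on (frechet_derivative \<phi> (at 0 within S)) S"
    using c
    by - (rule exI [of _ S], rule exI [of _ U2], rule exI [of _ "V \<inter> V'"], rule exI [of _ \<phi>],
      rule exI [of _ \<psi>], intro conjI; assumption)
qed

text \<open>The chart at \<open>\<Psi> y\<close> is the translation by \<open>y\<close> followed by
  \<open>\<Psi>\<close>. As \<open>y\<close> lies in \<open>K\<close>, this translation maps
  \<open>K\<close> onto itself.\<close>

lemma submanifold_diffeo_image_subspace:
  fixes K :: "(real^'n) set" and \<Phi> \<Psi> :: "real^'n \<Rightarrow> real^'n"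
  assumes "open U" "open W" and hom: "homeomorphism U W \<Phi> \<Psi>" and \<Psi>: "Ck_on k UNIV W \<Psi>" "k \<ge> 1"
    and inj: "\<And>y. y \<in> W \<Longrightarrow> inj (frechet_derivative \<Psi> (at y))"
    and K: "subspace K" "dim K = m"
  shows "submanifold k m (\<Psi> ` (W \<inter> K))"
proof (rule submanifoldI)
  fix x assume "x \<in> \<Psi> ` (W \<inter> K)"
  then obtain y where y: "y \<in> W" "y \<in> K" "x = \<Psi> y" by blast
  define W0 where "W0 = (+) y -` W"
  define \<phi> where "\<phi> u = \<Psi> (y + u)" for u
  have W0: "open W0" "0 \<in> W0"
    using assms(2) y by (auto simp: W0_def intro!: open_vimage continuous_intros)
  have "Ck_on k UNIV W0 \<phi>"
    unfolding \<phi>_def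
    by (rule Ck_on_compose [OF W0(1) assms(2) \<Psi>(1)])
      (use W0 in \<open>auto simp: W0_def intro!: Ck_on_add Ck_on_const Ck_on_id\<close>)
  then have Ck: "Ck_on k K (W0 \<inter> K) \<phi>"
    by (rule Ck_on_restrict_subspace [OF W0(1) K(1)])
  have trans: "y + u \<in> K \<longleftrightarrow> u \<in> K" for u
    using y K(1) by (metis subspace_add subspace_diff add_diff_cancel_left')
  have im: "\<phi> ` (W0 \<inter> K) = \<Psi> ` (W \<inter> K)"
  proof
    show "\<phi> ` (W0 \<inter> K) \<subseteq> \<Psi> ` (W \<inter> K)"
      using trans by (auto simp: \<phi>_def W0_def)
    show "\<Psi> ` (W \<inter> K) \<subseteq> \<phi> ` (W0 \<inter> K)"
    proof
      fix z assume "z \<in> \<Psi> ` (W \<inter> K)"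
      then obtain w where "w \<in> W" "w \<in> K" "z = \<Psi> w" by blast
      then have "z = \<phi> (w - y)" "w - y \<in> W0 \<inter> K"
        using trans [of "w - y"] by (auto simp: \<phi>_def W0_def)
      then show "z \<in> \<phi> ` (W0 \<inter> K)" by blast
    qed
  qed
  have sub: "\<Psi> ` (W \<inter> K) \<subseteq> U" using hom by (auto simp: homeomorphism_def)
  have "homeomorphism (W0 \<inter> K) (\<phi> ` (W0 \<inter> K)) \<phi> (\<lambda>z. \<Phi> z - y)"
  proof (rule homeomorphismI)
    show "continuous_on (W0 \<inter> K) \<phi>" using Ck by (rule Ck_on_imp_continuous_on)
    show "continuous_on (\<phi> ` (W0 \<inter> K)) (\<lambda>z. \<Phi> z - y)"
      unfolding im using hom sub
      by (intro continuous_intros) (auto simp: homeomorphism_def intro: continuous_on_subset)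
    have inv: "\<Phi> (\<phi> u) - y = u" if "u \<in> W0 \<inter> K" for u
      using that hom by (auto simp: \<phi>_def W0_def homeomorphism_def)
    then show "\<And>u. u \<in> W0 \<inter> K \<Longrightarrow> \<Phi> (\<phi> u) - y = u" .
    show "(\<lambda>z. \<Phi> z - y) ` \<phi> ` (W0 \<inter> K) \<subseteq> W0 \<inter> K"
      using inv by auto
    show "\<phi> (\<Phi> z - y) = z" if "z \<in> \<phi> ` (W0 \<inter> K)" for z
      using that inv by auto
  qed auto
  moreover have "inj_on (frechet_derivative \<phi> (at 0 within K)) K"
  proof -
    let ?D = "frechet_derivative \<Psi> (at y)"
    have "Ck_on (Suc 0) UNIV W \<Psi>" using \<Psi> by (auto intro: Ck_on_mono)
    then have "(\<Psi> has_derivative ?D) (at (y + 0))"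
      using y by (simp add: Ck_on_Suc frechet_derivative_works)
    moreover have "((+) y has_derivative (\<lambda>u. u)) (at 0)"
      by (auto intro!: derivative_eq_intros)
    ultimately have "(\<phi> has_derivative ?D) (at 0)"
      unfolding \<phi>_def using has_derivative_compose by blast
    then have D: "(\<phi> has_derivative ?D) (at 0 within K)"
      by (rule has_derivative_at_withinI)
    then have "(\<phi> has_derivative frechet_derivative \<phi> (at 0 within K)) (at 0 within K)"
      by (meson differentiable_def frechet_derivative_works)
    \<comment> \<open>Within \<open>K\<close> the derivative is compared only along vectors of
      \<open>K\<close>, which is all that injectivity on \<open>K\<close> needs.\<close>
    then have "frechet_derivative \<phi> (at 0 within K) v = ?D v" if "v \<in> K" for v
      using has_derivative_within_subspace_unique [OF _ D K(1) subspace_0 [OF K(1)] that] by blast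
    then show ?thesis
      using inj [OF y(1)] by (auto simp: inj_on_def)
  qed
  moreover have "openin (top_of_set K) (W0 \<inter> K)"
    using W0 by (auto simp: openin_open)
  \<comment> \<open>One chart covers the whole image, so \<open>U\<close> itself serves as its open
    set.\<close>
  moreover have "\<phi> ` (W0 \<inter> K) = \<Psi> ` (W \<inter> K) \<inter> U" using im sub by blast
  moreover have "0 \<in> W0 \<inter> K" "\<phi> 0 = x"
    using W0 K subspace_0 y by (auto simp: \<phi>_def)
  ultimately show "\<exists>S U' V \<phi> \<psi>. subspace S \<and> dim S = m \<and> openin (top_of_set S) U' \<and> 0 \<in> U' \<and> open V \<and>
        Ck_on k S U' (\<phi> :: real^'n \<Rightarrow> real^'n) \<and> \<phi> 0 = x \<and> \<phi> ` U' = \<Psi> ` (W \<inter> K) \<inter> V \<and>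
        homeomorphism U' (\<phi> ` U') \<phi> \<psi> \<and> inj_on (frechet_derivative \<phi> (at 0 within S)) S"
    using K assms(1) Ck
    by - (rule exI [of _ K], rule exI [of _ "W0 \<inter> K"], rule exI [of _ U], rule exI [of _ \<phi>],
      rule exI [of _ "\<lambda>z. \<Phi> z - y"], intro conjI; assumption)
qed

section \<open>Zeros of non-negative functions\<close>

text \<open>Were \<open>u = H *v v\<close> nonzero, moving from \<open>v\<close> a little in
  direction \<open>- u\<close> would make the quadratic form negative: its first-order term is
  \<open>- 2 * t * (u \<bullet> u)\<close>.\<close>

lemma psd_matrix_null:
  fixes H :: "real^'n^'n"
  assumes symm: "\<And>u v. u \<bullet> (H *v v) = v \<bullet> (H *v u)" and psd: "\<And>u. 0 \<le> u \<bullet> (H *v u)"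
    and "v \<bullet> (H *v v) = 0"
  shows "H *v v = 0"
proof (rule ccontr)
  assume nz: "H *v v \<noteq> 0"
  define u where "u = H *v v"
  define c where "c = u \<bullet> (H *v u)"
  have expand: "(v - t *\<^sub>R u) \<bullet> (H *v (v - t *\<^sub>R u)) = t * (t * c - 2 * (u \<bullet> u))" for t
  proof -
    have "(v - t *\<^sub>R u) \<bullet> (H *v (v - t *\<^sub>R u)) =
        v \<bullet> (H *v v) - t * (v \<bullet> (H *v u)) - t * (u \<bullet> (H *v v)) + t * t * c"
      by (simp add: c_def matrix_vector_mult_diff_distrib matrix_vector_mult_scaleR inner_diff algebra_simps)
    also have "v \<bullet> (H *v u) = u \<bullet> u" using symm [of v u] by (simp add: u_def)
    finally show ?thesis using assms(3) by (simp add: u_def [symmetric] algebra_simps)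
  qed
  have pos: "u \<bullet> u > 0" using nz by (simp add: u_def)
  \<comment> \<open>Makes \<open>t * c\<close> at most \<open>u \<bullet> u\<close>, so that the
    linear term dominates; the summand 1 covers \<open>c = 0\<close>.\<close>
  define t where "t = (u \<bullet> u) / (c + 1)"
  have c: "c \<ge> 0" using psd by (simp add: c_def)
  then have t: "t > 0" using pos by (simp add: t_def)
  have "t * c \<le> u \<bullet> u" using c pos by (simp add: t_def field_simps)
  then have "t * c - 2 * (u \<bullet> u) < 0" using pos by linarith
  with t have "t * (t * c - 2 * (u \<bullet> u)) < 0" by (rule mult_pos_neg)
  with expand [of t] psd [of "v - t *\<^sub>R u"] show False by simp
qed

lemma has_integral_one_minus: "((\<lambda>t::real. 1 - t) has_integral 1 / 2) {0..1}"
proof -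
  have "((\<lambda>t::real. 1 - t) has_integral (1 - 1\<^sup>2 / 2) - (0 - 0\<^sup>2 / 2)) {0..1}"
    by (rule fundamental_theorem_of_calculus)
      (auto simp: has_real_derivative_iff_has_vector_derivative [symmetric] intro!: derivative_eq_intros)
  then show ?thesis by simp
qed

lemma iter_deriv2_quadratic_form:
  fixes f :: "'a::real_normed_vector \<Rightarrow> real"
  assumes "open \<Omega>" "Ck_on 2 UNIV \<Omega> f" "x \<in> \<Omega>"
  shows "iter_deriv UNIV [\<Sum>i<r. w i *\<^sub>R b i, \<Sum>i<r. w i *\<^sub>R b i] f x =
    (\<Sum>i<r. \<Sum>j<r. iter_deriv UNIV [b i, b j] f x * w i * w j)"
proof -
  note lin = linear_iter_deriv2 [OF assms]
  have "iter_deriv UNIV [\<Sum>i<r. w i *\<^sub>R b i, \<Sum>i<r. w i *\<^sub>R b i] f x =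
      (\<Sum>i<r. w i * iter_deriv UNIV [b i, \<Sum>j<r. w j *\<^sub>R b j] f x)"
    using linear_sum [OF lin(1), of "\<lambda>i. w i *\<^sub>R b i" "{..<r}"] linear_cmul [OF lin(1)]
    by (simp del: iter_deriv.simps)
  also have "\<dots> = (\<Sum>i<r. w i * (\<Sum>j<r. w j * iter_deriv UNIV [b i, b j] f x))"
    using linear_sum [OF lin(2), of _ "\<lambda>i. w i *\<^sub>R b i" "{..<r}"] linear_cmul [OF lin(2)]
    by (simp del: iter_deriv.simps)
  finally show ?thesis
    by (simp add: sum_distrib_left mult_ac del: iter_deriv.simps)
qed

text \<open>The analytic half of the theorem, separated from the construction of \<open>q\<close>.
  The coefficients of the quadratic form are averages of second derivatives of \<open>f\<close>
  along segments, which is where two orders of smoothness are lost.\<close>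

lemma sum_of_squares_near_zero_set:
  fixes f :: "real^'n \<Rightarrow> real" and b :: "nat \<Rightarrow> real^'n" and q :: "real^'n \<Rightarrow> real^'n"
  assumes "open \<Omega>" "x0 \<in> \<Omega>" and f: "Ck_on (Suc (Suc m)) UNIV \<Omega> f"
    and pos: "\<And>w. \<exists>i<r. w i \<noteq> 0 \<Longrightarrow>
      0 < iter_deriv UNIV [\<Sum>i<r. w i *\<^sub>R b i, \<Sum>i<r. w i *\<^sub>R b i] f x0"
    and q: "open U" "x0 \<in> U" "Ck_on m UNIV U q" "q x0 = x0"
    and zero: "\<And>x. x \<in> U \<Longrightarrow> q x \<in> \<Omega> \<and> f (q x) = 0 \<and> frechet_derivative f (at (q x)) = (\<lambda>_. 0)"
    and span: "\<And>x. x \<in> U \<Longrightarrow> x - q x = (\<Sum>i<r. ((x - q x) \<bullet> b i) *\<^sub>R b i)"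
  shows "\<exists>V fs. open V \<and> x0 \<in> V \<and> V \<subseteq> U \<and> (\<forall>i<r. Ck_on m UNIV V (fs i)) \<and>
    (\<forall>x\<in>V. f x = (\<Sum>i<r. (fs i x)\<^sup>2))"
proof -
  obtain \<rho> where \<rho>: "\<rho> > 0" "ball x0 \<rho> \<subseteq> \<Omega>"
    using assms(1,2) open_contains_ball by blast
  \<comment> \<open>A ball is convex, so the segments from \<open>q x\<close> to \<open>x\<close>
    remain in the domain once both endpoints lie in it.\<close>
  define B where "B = ball x0 \<rho>"
  have B: "open B" "convex B" "x0 \<in> B" "B \<subseteq> \<Omega>" using \<rho> by (auto simp: B_def)
  have f2: "Ck_on 2 UNIV \<Omega> f"
    using Ck_on_mono [OF f] by (simp add: numeral_2_eq_2)
  have f2B: "Ck_on 2 UNIV B f"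
    using Ck_on_mono [OF f2] B by blast
  define U1 where "U1 = (U \<inter> q -` B) \<inter> B"
  have U1: "open U1" "x0 \<in> U1" "U1 \<subseteq> U" "U1 \<subseteq> B" "q ` U1 \<subseteq> B"
    using q B continuous_open_preimage [OF Ck_on_imp_continuous_on [OF q(3)] q(1) B(1)]
    by (auto simp: U1_def)
  have qU1: "Ck_on m UNIV U1 q" using Ck_on_mono [OF q(3)] U1 by blast
  have D2: "Ck_on m UNIV B (iter_deriv UNIV [u, v] f)" for u v
    using Ck_on_mono [OF Ck_on_iter_deriv2 [OF f]] B by blast
  define A where "A i j x = integral {0..1} (\<lambda>t. (1 - t) * iter_deriv UNIV [b i, b j] f (q x + t *\<^sub>R (x - q x)))"
    for i j x
  have seg: "q x + t *\<^sub>R (x - q x) \<in> B" if "x \<in> U1" "t \<in> {0..1}" for x t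
  proof -
    have "(1 - t) *\<^sub>R q x + t *\<^sub>R x \<in> B"
      using convexD_alt [OF B(2), of "q x" x t] that U1 by auto
    then show ?thesis by (simp add: algebra_simps)
  qed
  have A_Ck: "Ck_on m UNIV U1 (A i j)" for i j
    unfolding A_def
    by (rule Ck_on_segment_integral [OF B(1,2) D2 _ U1(1) qU1 Ck_on_id])
      (use U1 in \<open>auto intro!: continuous_intros\<close>)
  have A_form: "f x = (\<Sum>i<r. \<Sum>j<r. A i j x * ((x - q x) \<bullet> b i) * ((x - q x) \<bullet> b j))"
    if x: "x \<in> U1" for x
  proof -
    let ?w = "\<lambda>i. (x - q x) \<bullet> b i" and ?s = "\<lambda>t. q x + t *\<^sub>R (x - q x)"
    have int: "(\<lambda>t. (1 - t) * iter_deriv UNIV [b i, b j] f (?s t)) integrable_on {0..1}" for i j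
    proof (rule integrable_continuous_real)
      have "continuous_on {0..1} (\<lambda>t. iter_deriv UNIV [b i, b j] f (?s t))"
        by (rule continuous_on_compose2 [OF Ck_on_imp_continuous_on [OF D2]])
          (use seg [OF x] in \<open>auto intro!: continuous_intros\<close>)
      then show "continuous_on {0..1} (\<lambda>t. (1 - t) * iter_deriv UNIV [b i, b j] f (?s t))"
        by (intro continuous_intros)
    qed
    have 1: "((\<lambda>t. (1 - t) * iter_deriv UNIV [x - q x, x - q x] f (?s t)) has_integral f x) {0..1}"
      using taylor_integral_remainder [OF B(2) f2B, of "q x" x] zero [of x] x U1 by auto
    have 2: "((\<lambda>t. \<Sum>i<r. \<Sum>j<r. (1 - t) * iter_deriv UNIV [b i, b j] f (?s t) * (?w i * ?w j))
        has_integral (\<Sum>i<r. \<Sum>j<r. A i j x * (?w i * ?w j))) {0..1}"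
      unfolding A_def
      by (intro has_integral_sum has_integral_mult_left integrable_integral int finite_lessThan)
    have 3: "(1 - t) * iter_deriv UNIV [x - q x, x - q x] f (?s t) =
        (\<Sum>i<r. \<Sum>j<r. (1 - t) * iter_deriv UNIV [b i, b j] f (?s t) * (?w i * ?w j))"
      if "t \<in> {0..1}" for t
    proof -
      have "iter_deriv UNIV [x - q x, x - q x] f (?s t) =
          iter_deriv UNIV [\<Sum>i<r. ?w i *\<^sub>R b i, \<Sum>i<r. ?w i *\<^sub>R b i] f (?s t)"
        using arg_cong [OF span, of x "\<lambda>v. iter_deriv UNIV [v, v] f (?s t)"] x U1(3) by blast
      also have "\<dots> = (\<Sum>i<r. \<Sum>j<r. iter_deriv UNIV [b i, b j] f (?s t) * ?w i * ?w j)"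
        by (rule iter_deriv2_quadratic_form [OF B(1) f2B seg [OF x that]])
      finally show ?thesis by (simp add: sum_distrib_left mult_ac del: iter_deriv.simps)
    qed
    have "f x = (\<Sum>i<r. \<Sum>j<r. A i j x * (?w i * ?w j))"
      by (rule has_integral_unique [OF has_integral_eq [OF 3 1] 2])
    then show ?thesis by (simp add: mult.assoc)
  qed
  \<comment> \<open>Since \<open>q x0 = x0\<close> the segment at \<open>x0\<close> is a single
    point, and the weight \<open>1 - t\<close> has integral one half.\<close>
  have A_x0: "A i j x0 = iter_deriv UNIV [b i, b j] f x0 / 2" for i j
    using integral_unique [OF has_integral_mult_left [OF has_integral_one_minus]]
    by (simp add: A_def q(4) del: iter_deriv.simps)
  have "\<exists>V L. open V \<and> x0 \<in> V \<and> V \<subseteq> U1 \<and> (\<forall>i<r. \<forall>j<r. Ck_on m UNIV V (L i j)) \<and>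
    (\<forall>x\<in>V. \<forall>w. (\<Sum>i<r. \<Sum>j<r. A i j x * w i * w j) = (\<Sum>i<r. (\<Sum>j<r. L i j x * w j)\<^sup>2))"
  proof (rule Ck_on_cholesky [OF U1(1,2) A_Ck])
    show "A i j x = A j i x" if "x \<in> U1" for i j x
      unfolding A_def
      by (rule integral_cong) (metis iter_deriv_symmetric [OF B(1) f2B seg [OF that]])
    show "0 < (\<Sum>i<r. \<Sum>j<r. A i j x0 * w i * w j)" if w: "\<exists>i<r. w i \<noteq> 0" for w
    proof -
      have "(\<Sum>i<r. \<Sum>j<r. A i j x0 * w i * w j) =
          (\<Sum>i<r. \<Sum>j<r. iter_deriv UNIV [b i, b j] f x0 * w i * w j) / 2"
        by (simp add: A_x0 sum_divide_distrib del: iter_deriv.simps)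
      also have "\<dots> > 0"
        using pos [OF w] unfolding iter_deriv2_quadratic_form [OF assms(1) f2 assms(2)]
        by (simp del: iter_deriv.simps)
      finally show ?thesis .
    qed
  qed
  then obtain V L where V: "open V" "x0 \<in> V" "V \<subseteq> U1"
    and L: "\<forall>i<r. \<forall>j<r. Ck_on m UNIV V (L i j)"
    and Leq: "\<forall>x\<in>V. \<forall>w. (\<Sum>i<r. \<Sum>j<r. A i j x * w i * w j) = (\<Sum>i<r. (\<Sum>j<r. L i j x * w j)\<^sup>2)"
    by (elim exE conjE) (rule that)
  \<comment> \<open>The rows of the Cholesky factor applied to the coordinates of
    \<open>x - q x\<close> in the family \<open>b\<close>.\<close>
  define fs where "fs i x = (\<Sum>j<r. L i j x * ((x - q x) \<bullet> b j))" for i x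
  have "Ck_on m UNIV V (fs i)" if "i < r" for i
    unfolding fs_def using that L
    by (intro Ck_on_sum V Ck_on_mult Ck_on_bounded_linear [OF V(1) bounded_linear_inner_left]
        Ck_on_diff Ck_on_id Ck_on_mono [OF qU1]) auto
  moreover have "f x = (\<Sum>i<r. (fs i x)\<^sup>2)" if "x \<in> V" for x
    using A_form [of x] Leq V(3) that by (auto simp: fs_def)
  ultimately show ?thesis
    using V U1(3) by blast
qed

theorem theorem2p3:
  fixes f :: "real^'n \<Rightarrow> real" and \<Omega> :: "(real^'n) set" and x0 :: "real^'n"
    and p k d0 :: nat and N :: "(real^'n) set"
  defines "Z \<equiv> {x \<in> \<Omega>. f x = 0}"
  assumes p: "p \<ge> 2"
    and \<Omega>: "open \<Omega>" "x0 \<in> \<Omega>"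
    and f_Cp: "Ck_on p UNIV \<Omega> f"
    and f_nonneg: "\<forall>x\<in>\<Omega>. f x \<ge> 0"
    and f_x0: "f x0 = 0"
    and k: "k \<ge> 1"
    and N: "submanifold k d0 N" "x0 \<in> N" "N \<subseteq> Z"
    and rank: "rank (hessian f x0) = CARD('n) - d0"
  shows "\<exists>U. open U \<and> x0 \<in> U \<and> U \<subseteq> \<Omega> \<and>
           submanifold (max k (p - 1)) d0 (U \<inter> Z) \<and>
           (\<exists>fs :: nat \<Rightarrow> real^'n \<Rightarrow> real.
              (\<forall>i\<in>{1..CARD('n) - d0}. Ck_on (p - 2) UNIV U (fs i)) \<and>
              (\<forall>x\<in>U. f x = (\<Sum>i = 1..CARD('n) - d0. (fs i x)^2)))"
proof -

  \<comment> \<open>The Hessian as a positive semidefinite form\<close>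
  define m where "m = p - 2"
  have pm: "p = Suc (Suc m)" using p by (simp add: m_def)
  have f: "Ck_on (Suc (Suc m)) UNIV \<Omega> f" using f_Cp pm by simp
  have f2: "Ck_on 2 UNIV \<Omega> f" using Ck_on_mono [OF f_Cp p] by simp
  define H where "H = hessian f x0"
  define r where "r = CARD('n) - d0"
  have inner_H: "u \<bullet> (H *v v) = iter_deriv UNIV [u, v] f x0" for u v
    unfolding H_def by (rule inner_hessian [OF \<Omega>(1) f2 \<Omega>(2)])
  have symm: "u \<bullet> (H *v v) = v \<bullet> (H *v u)" for u v
    unfolding inner_H by (rule iter_deriv_symmetric [OF \<Omega>(1) f2 \<Omega>(2)])
  have psd: "0 \<le> u \<bullet> (H *v u)" for u
    unfolding inner_H
    using iter_deriv2_nonneg_at_min [OF \<Omega>(1) f2 \<Omega>(2)] f_nonneg f_x0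
    by (simp del: iter_deriv.simps)
  have crit: "frechet_derivative f (at x) = (\<lambda>_. 0)" if "x \<in> Z" for x
    using frechet_derivative_zero_at_min [OF \<Omega>(1) f2, of x] that f_nonneg by (auto simp: Z_def)

  \<comment> \<open>Range and kernel of the Hessian\<close>
  define R where "R = range (\<lambda>x. H *v x)"
  define K where "K = {y. H *v y = 0}"
  have R: "subspace R" "dim R = r"
    using rank by (auto simp: R_def H_def r_def rank_dim_range
        intro!: linear_subspace_image matrix_vector_mul_linear subspace_UNIV)
  have K_eq: "K = {y \<in> UNIV. \<forall>x\<in>R. orthogonal x y}"
  proof -
    have "(\<forall>x. (H *v x) \<bullet> y = 0) \<longleftrightarrow> H *v y = 0" for y
      using symm [of y] inner_commute by (metis inner_eq_zero_iff inner_zero_right)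
    then show ?thesis by (auto simp: K_def R_def orthogonal_def)
  qed
  have K: "subspace K"
    unfolding K_def by (rule linear_subspace_kernel [OF matrix_vector_mul_linear])
  obtain S U' V and \<phi> \<psi> :: "real^'n \<Rightarrow> real^'n" where chart: "subspace S" "dim S = d0"
    "openin (top_of_set S) U'" "0 \<in> U'" "open V" "Ck_on k S U' \<phi>" "\<phi> 0 = x0" "\<phi> ` U' = N \<inter> V"
    "homeomorphism U' (\<phi> ` U') \<phi> \<psi>"
    by (rule submanifoldE [OF N(1,2)])
  \<comment> \<open>Subtraction on \<open>nat\<close> is truncated: only with this bound does
    \<open>dim R = CARD('n) - d0\<close> give \<open>dim K = d0\<close>.\<close>
  have "d0 \<le> CARD('n)" using dim_subset_UNIV [of S] chart(2) by simp
  then have dimK: "dim K = d0"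
    using dim_subspace_orthogonal_to_vectors [OF R(1) subspace_UNIV] R(2)
    by (simp add: K_eq r_def)

  \<comment> \<open>An orthonormal basis of the range and the orthogonal projections\<close>
  obtain B where B: "B \<subseteq> R" "pairwise orthogonal B" "\<And>x. x \<in> B \<Longrightarrow> norm x = 1"
    "independent B" "card B = r" "span B = R"
    using orthonormal_basis_subspace [OF R(1)] R(2) by metis
  have finB: "finite B" using B(4) independent_imp_finite by blast
  obtain b where b: "bij_betw b {..<r} B"
    using ex_bij_betw_nat_finite [OF finB] B(5) by (auto simp: atLeast0LessThan)
  have bR: "b i \<in> R" if "i < r" for i
    using b B(1) that by (auto simp: bij_betw_def)
  have bb: "b i \<bullet> b j = (if i = j then 1 else 0)" if "i < r" "j < r" for i j
  proof (cases "i = j")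
    case True
    then show ?thesis using B(3) b that by (auto simp: bij_betw_def norm_eq_1)
  next
    case False
    then have "b i \<noteq> b j" using b that by (auto simp: bij_betw_def inj_on_def)
    moreover have "b i \<in> B" "b j \<in> B" using b that by (auto simp: bij_betw_def)
    ultimately show ?thesis using B(2) False by (auto simp: pairwise_def orthogonal_def)
  qed
  \<comment> \<open>\<open>Q\<close> is the orthogonal projection onto \<open>R\<close>. Its
    explicit form makes \<open>P v = 0\<close> literally the expansion of \<open>v\<close> in the
    family \<open>b\<close>, as the sum of squares requires.\<close>
  define Q where "Q v = (\<Sum>i<r. (v \<bullet> b i) *\<^sub>R b i)" for v
  define P where "P v = v - Q v" for v
  have Q_R: "Q v = v" if "v \<in> R" for v
  proof -
    have "(\<Sum>i\<in>B. (v \<bullet> i) *\<^sub>R i) = v"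
      using orthonormal_basis_expand [OF B(2) B(3) _ finB] that B(6) by simp
    then show ?thesis
      unfolding Q_def using sum.reindex_bij_betw [OF b, of "\<lambda>i. (v \<bullet> i) *\<^sub>R i"] by simp
  qed
  have linP: "bounded_linear P"
    unfolding P_def Q_def by (intro bounded_linear_intros)
  have PK: "P v \<in> K" for v
  proof -
    have "P v \<bullet> b i = 0" if "i < r" for i
    proof -
      have "Q v \<bullet> b i = (\<Sum>j<r. (v \<bullet> b j) * (b j \<bullet> b i))"
        by (simp add: Q_def inner_sum_left)
      also have "\<dots> = (\<Sum>j<r. if j = i then v \<bullet> b j else 0)"
        using that by (intro sum.cong) (auto simp: bb)
      also have "\<dots> = v \<bullet> b i" using that by simp
      finally show ?thesis by (simp add: P_def inner_diff_left)
    qed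
    then have "x \<bullet> P v = 0" if "x \<in> R" for x
      using Q_R [OF that] inner_sum_left [of "\<lambda>i. (x \<bullet> b i) *\<^sub>R b i" "{..<r}" "P v"]
      by (simp add: Q_def inner_commute)
    then show ?thesis by (auto simp: K_eq orthogonal_def)
  qed
  have P_id: "P v = v" if "v \<in> K" for v
  proof -
    have "v \<bullet> b i = 0" if "i < r" for i
      using bR [OF that] \<open>v \<in> K\<close> by (auto simp: K_eq orthogonal_def inner_commute)
    then show ?thesis by (simp add: P_def Q_def)
  qed
  have KR: "v = 0" if "v \<in> K" "v \<in> R" for v
    using that by (auto simp: K_eq orthogonal_def)

  \<comment> \<open>The map \<Phi> and its local inverse\<close>
  define gr where "gr x = (\<chi> i. frechet_derivative f (at x) (axis i 1))" for x
  define \<Phi> where "\<Phi> x = P x + gr x" for x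
  have \<Phi>_Ck: "Ck_on (Suc m) UNIV \<Omega> \<Phi>"
    unfolding \<Phi>_def gr_def using f
    by (intro Ck_on_add Ck_on_vec_lambda Ck_on_bounded_linear [OF \<Omega>(1) linP] Ck_on_id \<Omega>)
      (simp add: Ck_on_Suc)
  have gr_Z: "gr x = 0" if "x \<in> Z" for x
    using crit [OF that] by (simp add: gr_def vec_eq_iff)
  have \<Phi>_Z: "\<Phi> x = P x" if "x \<in> Z" for x
    using gr_Z [OF that] by (simp add: \<Phi>_def)
  have gr_der: "(gr has_derivative (\<lambda>v. H *v v)) (at x0)"
    unfolding has_derivative_componentwise_within [of gr]
  proof
    fix e :: "real^'n" assume "e \<in> Basis"
    then obtain i where e: "e = axis i 1" by (auto simp: Basis_vec_def)
    have "(\<lambda>x. gr x \<bullet> e) = (\<lambda>x. frechet_derivative f (at x) e)"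
      by (simp add: e gr_def inner_axis)
    \<comment> \<open>Symmetry of \<open>H\<close> puts \<open>v\<close> in the outer slot, where
      the derivative of a gradient component has it.\<close>
    moreover have "(\<lambda>v. (H *v v) \<bullet> e) = (\<lambda>v. iter_deriv UNIV [v, e] f x0)"
      using inner_H symm inner_commute by metis
    ultimately show "((\<lambda>x. gr x \<bullet> e) has_derivative (\<lambda>v. (H *v v) \<bullet> e)) (at x0)"
      using has_derivative_iter_deriv(2) [OF f2 \<Omega>(2), of e] by (simp only:)
  qed
  have \<Phi>_der: "(\<Phi> has_derivative (\<lambda>v. P v + H *v v)) (at x0)"
    unfolding \<Phi>_def by (intro has_derivative_add gr_der bounded_linear_imp_has_derivative linP)
  \<comment> \<open>\<open>P v\<close> lies in \<open>K\<close> and \<open>H *v v\<close> in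
    \<open>R\<close>, which meet only in 0. If the sum vanishes, so do both terms; then
    \<open>v\<close> is in \<open>K\<close> and equals \<open>P v\<close>.\<close>
  have "inj (\<lambda>v. P v + H *v v)"
  proof (subst linear_injective_0 [OF has_derivative_linear [OF \<Phi>_der]], intro allI impI)
    fix v assume eq: "P v + H *v v = 0"
    have "H *v v \<in> R" by (simp add: R_def)
    moreover have "P v = - (H *v v)" using eq by (simp add: eq_neg_iff_add_eq_0)
    ultimately have "P v \<in> R" using subspace_neg [OF R(1)] by simp
    then have "P v = 0" using KR PK by blast
    then have "v \<in> K" using eq by (simp add: K_def)
    then show "v = 0" using P_id \<open>P v = 0\<close> by simp
  qed
  from inverse_function_Ck [OF \<Omega> \<Phi>_Ck \<Phi>_der this]
  obtain U1 W \<Psi> where U1: "open U1" "U1 \<subseteq> \<Omega>" "x0 \<in> U1" and W: "open W"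
    and hom: "homeomorphism U1 W \<Phi> \<Psi>" and \<Psi>: "Ck_on (Suc m) UNIV W \<Psi>"
    and \<Psi>_inj: "\<And>y. y \<in> W \<Longrightarrow> inj (frechet_derivative \<Psi> (at y))"
    by blast
  have \<Phi>W: "\<Phi> x \<in> W" "\<Psi> (\<Phi> x) = x" if "x \<in> U1" for x
    using hom that by (auto simp: homeomorphism_def)
  have \<Psi>U: "\<Psi> y \<in> U1" "\<Phi> (\<Psi> y) = y" if "y \<in> W" for y
    using hom that by (auto simp: homeomorphism_def)

  \<comment> \<open>The zero set near \<open>x0\<close>\<close>
  define U2 where "U2 = U' \<inter> \<phi> -` U1"
  have cont\<phi>: "continuous_on U' \<phi>" using chart(6) by (rule Ck_on_imp_continuous_on)
  have U2: "openin (top_of_set S) U2" "0 \<in> U2" "U2 \<subseteq> U'"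
    using continuous_openin_preimage_gen [OF cont\<phi> U1(1)] chart(3,4,7) U1(3) openin_trans
    by (auto simp: U2_def)
  have \<phi>U2: "\<phi> u \<in> N" "\<phi> u \<in> Z" "\<phi> u \<in> U1" if "u \<in> U2" for u
    using that chart(8) N(3) by (auto simp: U2_def)
  \<comment> \<open>Read in the chart of \<open>N\<close>, \<Phi> is a continuous injection between
    subspaces of equal dimension \<open>d0\<close>; it lands in \<open>K\<close> because it
    coincides with \<open>P\<close> on zeros.\<close>
  have "openin (top_of_set K) ((\<lambda>u. \<Phi> (\<phi> u)) ` U2)"
  proof (rule invariance_of_domain_subspaces [OF U2(1) chart(1) K])
    show "dim K \<le> dim S" using dimK chart(2) by simp
    show "continuous_on U2 (\<lambda>u. \<Phi> (\<phi> u))"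
      by (rule continuous_on_compose2 [OF Ck_on_imp_continuous_on [OF \<Phi>_Ck]])
        (use continuous_on_subset [OF cont\<phi> U2(3)] \<phi>U2 U1(2) in auto)
    show "(\<lambda>u. \<Phi> (\<phi> u)) \<in> U2 \<rightarrow> K" using \<Phi>_Z \<phi>U2 PK by auto
    show "inj_on (\<lambda>u. \<Phi> (\<phi> u)) U2"
    proof (rule inj_onI)
      fix u v assume uv: "u \<in> U2" "v \<in> U2" "\<Phi> (\<phi> u) = \<Phi> (\<phi> v)"
      then have "\<phi> u = \<phi> v" using \<Phi>W(2) \<phi>U2(3) by metis
      then show "u = v" using chart(9) uv U2(3) by (metis homeomorphism_def subsetD)
    qed
  qed
  then obtain T where T: "open T" "(\<lambda>u. \<Phi> (\<phi> u)) ` U2 = K \<inter> T"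
    by (auto simp: openin_open)
  \<comment> \<open>After this cut every point of \<open>W' \<inter> K\<close> is the image of a
    point of \<open>N\<close>, so \<Psi> sends \<open>W' \<inter> K\<close> into
    \<open>N\<close>.\<close>
  define W' where "W' = W \<inter> T"
  define U3 where "U3 = U1 \<inter> \<Phi> -` T"
  have W': "open W'" "W' \<subseteq> W" using W T by (auto simp: W'_def)
  have \<Phi>x0: "\<Phi> x0 = P x0" using \<Phi>_Z N by blast
  have U3: "open U3" "U3 \<subseteq> \<Omega>" "x0 \<in> U3"
  proof -
    show "open U3"
      unfolding U3_def using hom
      by (intro continuous_open_preimage U1 T) (simp add: homeomorphism_def)
    show "U3 \<subseteq> \<Omega>" using U1 by (auto simp: U3_def)
    have "\<Phi> x0 \<in> T" using T(2) U2(2) chart(7) by auto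
    then show "x0 \<in> U3" using U1 by (simp add: U3_def)
  qed
  have hom': "homeomorphism U3 W' \<Phi> \<Psi>"
    by (rule homeomorphism_of_subsets [OF hom]) (use \<Phi>W \<Psi>U in \<open>force simp: U3_def W'_def\<close>)+
  have \<Psi>K: "\<Psi> y \<in> N \<inter> U3" if "y \<in> W' \<inter> K" for y
  proof -
    from that obtain u where u: "u \<in> U2" "y = \<Phi> (\<phi> u)" using T(2) by (auto simp: W'_def)
    then have "\<Psi> y = \<phi> u" using \<Phi>W(2) \<phi>U2(3) by simp
    moreover have "\<Psi> y \<in> U3" using that hom' by (auto simp: homeomorphism_def)
    ultimately show ?thesis using \<phi>U2(1) u by simp
  qed
  have Z\<Psi>: "Z \<inter> U3 \<subseteq> \<Psi> ` (W' \<inter> K)"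
  proof
    fix x assume x: "x \<in> Z \<inter> U3"
    then have "\<Phi> x \<in> W' \<inter> K" "\<Psi> (\<Phi> x) = x"
      using \<Phi>_Z [of x] PK [of x] \<Phi>W [of x] by (auto simp: U3_def W'_def)
    then show "x \<in> \<Psi> ` (W' \<inter> K)" by (metis imageI)
  qed
  have Z_eq: "Z \<inter> U3 = \<Psi> ` (W' \<inter> K)" "Z \<inter> U3 = N \<inter> U3"
    using Z\<Psi> \<Psi>K N(3) by auto
  have "submanifold (Suc m) d0 (Z \<inter> U3)"
    unfolding Z_eq(1)
    by (rule submanifold_diffeo_image_subspace [OF U3(1) W'(1) hom' _ _ _ K dimK])
      (use Ck_on_mono [OF \<Psi> _ W'(2)] \<Psi>_inj W'(2) in auto)
  moreover have "submanifold k d0 (Z \<inter> U3)"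
    unfolding Z_eq(2) by (rule submanifold_Int_open [OF N(1) U3(1)])
  \<comment> \<open>The maximum is one of the two classes just established, so no chart has to serve
    both.\<close>
  ultimately have subm: "submanifold (max k (p - 1)) d0 (Z \<inter> U3)"
    by (simp add: max_def pm)

  \<comment> \<open>Decomposition of \<open>f\<close> into squares\<close>
  define q where "q x = \<Psi> (P x)" for x
  define U4 where "U4 = U3 \<inter> P -` W'"
  have U4: "open U4" "x0 \<in> U4"
  proof -
    show "open U4"
      unfolding U4_def
      by (intro open_Int U3 open_vimage W' linear_continuous_on linP)
    have "\<Phi> x0 \<in> W'" using hom' U3(3) by (auto simp: homeomorphism_def)
    then show "x0 \<in> U4" using U3(3) \<Phi>x0 by (simp add: U4_def)
  qed
  have "Ck_on (Suc m) UNIV U4 q"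
    unfolding q_def
    by (rule Ck_on_compose [OF U4(1) W \<Psi> Ck_on_bounded_linear [OF U4(1) linP Ck_on_id [OF U4(1)]]])
      (use W' in \<open>auto simp: U4_def\<close>)
  then have q_Ck: "Ck_on m UNIV U4 q" by (rule Ck_on_mono) auto
  have qx0: "q x0 = x0" using \<Phi>x0 \<Phi>W(2) [OF U1(3)] by (simp add: q_def)
  have qZ: "q x \<in> Z" if "x \<in> U4" for x
    using \<Psi>K [of "P x"] PK N(3) that by (auto simp: q_def U4_def)
  have "\<exists>V fs. open V \<and> x0 \<in> V \<and> V \<subseteq> U4 \<and> (\<forall>i<r. Ck_on m UNIV V (fs i)) \<and>
    (\<forall>x\<in>V. f x = (\<Sum>i<r. (fs i x)\<^sup>2))"
  proof (rule sum_of_squares_near_zero_set [OF \<Omega> f _ U4 q_Ck qx0])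
    show "q x \<in> \<Omega> \<and> f (q x) = 0 \<and> frechet_derivative f (at (q x)) = (\<lambda>_. 0)" if "x \<in> U4" for x
      using qZ [OF that] crit by (simp add: Z_def)
    show "x - q x = (\<Sum>i<r. ((x - q x) \<bullet> b i) *\<^sub>R b i)" if "x \<in> U4" for x
    proof -
      \<comment> \<open>Both sides equal \<open>\<Phi> (q x)\<close>: the left because
        \<open>q x\<close> is a zero of \<open>f\<close>, the right because \<Psi> inverts
        \<Phi>.\<close>
      have "P (q x) = P x"
        using \<Phi>_Z [OF qZ [OF that]] \<Psi>U(2) [of "P x"] that W' by (auto simp: q_def U4_def)
      then have "P (x - q x) = 0" using linP by (simp add: bounded_linear.linear linear_diff)
      then show ?thesis by (simp add: P_def Q_def)
    qed
    show "0 < iter_deriv UNIV [\<Sum>i<r. w i *\<^sub>R b i, \<Sum>i<r. w i *\<^sub>R b i] f x0"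
      if w: "\<exists>i<r. w i \<noteq> 0" for w
    proof -
      define v where "v = (\<Sum>i<r. w i *\<^sub>R b i)"
      have vR: "v \<in> R" unfolding v_def by (intro subspace_sum subspace_mul R bR) auto
      have vb: "v \<bullet> b j = w j" if "j < r" for j
      proof -
        have "v \<bullet> b j = (\<Sum>i<r. w i * (b i \<bullet> b j))" by (simp add: v_def inner_sum_left)
        also have "\<dots> = (\<Sum>i<r. if i = j then w i else 0)"
          using that by (intro sum.cong) (auto simp: bb)
        finally show ?thesis using that by simp
      qed
      \<comment> \<open>The coordinates of \<open>v\<close> are the \<open>w j\<close>, not all
        zero. A nonzero vector of \<open>R\<close> is outside the kernel \<open>K\<close>, and a
        positive semidefinite form vanishes only on the kernel.\<close>
      have "v \<noteq> 0" using w vb by (metis inner_zero_left)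
      then have "H *v v \<noteq> 0" using KR [OF _ vR] by (auto simp: K_def)
      then have "v \<bullet> (H *v v) \<noteq> 0" using psd_matrix_null [OF symm psd] by blast
      then have "0 < v \<bullet> (H *v v)" using psd [of v] by simp
      then show ?thesis unfolding inner_H v_def .
    qed
  qed
  then obtain U fs where U: "open U" "x0 \<in> U" "U \<subseteq> U4" and fs: "\<forall>i<r. Ck_on m UNIV U (fs i)"
    and f_eq: "\<forall>x\<in>U. f x = (\<Sum>i<r. (fs i x)\<^sup>2)"
    by (elim exE conjE) (rule that)
  have "U \<inter> Z = (Z \<inter> U3) \<inter> U" using U(3) by (auto simp: U4_def)
  then have "submanifold (max k (p - 1)) d0 (U \<inter> Z)"
    using submanifold_Int_open [OF subm U(1)] by simp
  \<comment> \<open>The factorisation indexes its functions from 0, the theorem from 1, hence the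
    shift \<open>i - 1\<close>.\<close>
  moreover have "\<forall>i\<in>{1..CARD('n) - d0}. Ck_on (p - 2) UNIV U (fs (i - 1))"
    using fs by (auto simp: m_def [symmetric] r_def [symmetric])
  moreover have "\<forall>x\<in>U. f x = (\<Sum>i = 1..CARD('n) - d0. (fs (i - 1) x)^2)"
    using f_eq by (simp add: r_def [symmetric] sum.atLeast1_atMost_eq)
  moreover have "U \<subseteq> \<Omega>" using U(3) U3(2) by (auto simp: U4_def)
  ultimately show ?thesis using U(1,2) by (intro exI [of _ U] conjI exI [of _ "\<lambda>i. fs (i - 1)"])
qed

end
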